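(* Let $A,Q\in\mathbb{F}^{n\times n}$ with $Q$ Hermitian, and consider either the plus case, $X+A^Hf(X)^{-1}A=Q$, or the minus case, $X-A^Hf(X)^{-1}A=Q$, under the assumptions listed in the context. Let $r>1$ be an integer, and let $(\widehat A^{(k)},\widehat B^{(k)},\widehat Q^{(k)})_{k\ge1}$ be produced by the following algorithm. Set $(\widehat A^{(1)},\widehat B^{(1)},\widehat Q^{(1)}):=(A^{(1)},B^{(1)},Q^{(1)})$. For $k=1,2,\dots$: put $(A_1(k),B_1(k),Q_1(k)):=(\widehat A^{(k)},\widehat B^{(k)},\widehat Q^{(k)})$; for $i=1,\dots,r-2$ put $$A_{i+1}(k)=\widehat A^{(k)}(\widehat Q^{(k)}-B_i(k))^{-1}A_i(k),$$ $$B_{i+1}(k)=\widehat B^{(k)}+\widehat A^{(k)}(\widehat Q^{(k)}-B_i(k))^{-1}(\widehat A^{(k)})^H,$$ $$Q_{i+1}(k)=Q_i(k)-A_i(k)^H(\widehat Q^{(k)}-B_i(k))^{-1}A_i(k);$$ then put $$\widehat A^{(k+1)}=\widehat A^{(k)}(\widehat Q^{(k)}-B_{r-1}(k))^{-1}A_{r-1}(k),$$ $$\widehat B^{(k+1)}=\widehat B^{(k)}+\widehat A^{(k)}(\widehat Q^{(k)}-B_{r-1}(k))^{-1}(\widehat A^{(k)})^H,$$ $$\widehat Q^{(k+1)}=Q_{r-1}(k)-A_{r-1}(k)^H(\widehat Q^{(k)}-B_{r-1}(k))^{-1}A_{r-1}(k).$$ Then all these sequences are well-defined (all the inverses exist).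 If moreover $\rho(T_1)<1$, then $\widehat A^{(k)}\to0$, $\widehat Q^{(k)}\to X_M$ and $\widehat B^{(k)}\to Y_M$ R-superlinearly with order $r$, and $$\limsup_{k\to\infty}\|\widehat A^{(k+1)}\|^{1/r^{k}}\le\rho(T_1),\quad \limsup_{k\to\infty}\|\widehat Q^{(k+1)}-X_M\|^{1/r^{k}}\le\rho(T_1)^2,\quad \limsup_{k\to\infty}\|\widehat B^{(k+1)}-Y_M\|^{1/r^{k}}\le\rho(T_1)^2.$$
   Context: $\mathbb{F}$ is $\mathbb{R}$ or $\mathbb{C}$; $M^H$ is the conjugate transpose of $M$; $\rho$ is the spectral radius; $\|\cdot\|$ is a matrix norm; for Hermitian matrices, $X>Y$ ($X\ge Y$) means $X-Y$ is positive definite (positive semidefinite). The map $f:\mathbb{F}^{n\times n}\to\mathbb{F}^{n\times n}$ is continuous and satisfies, for all $M,N$: (a1) $f(f(M))=M$; (a2) $f(M+N)=f(M)+f(N)$; (a3) $f(MN)=f(M)f(N)$; (a4) $f(M)\ge0$ whenever $M\ge 0$. Plus case: assume the set $\{X_S>0 : X_S\le Q-A^Hf(X_S)^{-1}A\}$ is nonempty, and put $A^{(1)}:=f(A)f(Q)^{-1}A$, $B^{(1)}:=f(A)f(Q)^{-1}f(A)^H$, $Q^{(1)}:=Q-A^Hf(Q)^{-1}A$. Minus case: assume $Q>0$ and $A$ nonsingular, and put $A^{(1)}:=f(A)f(Q)^{-1}A$, $B^{(1)}:=-f(A)f(Q)^{-1}f(A)^H$, $Q^{(1)}:=Q+A^Hf(Q)^{-1}A$.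 In either case, for $k>1$ let $A^{(k)}:=A^{(1)}(Q^{(1)}-B^{(k-1)})^{-1}A^{(k-1)}$, $B^{(k)}:=B^{(1)}+A^{(1)}(Q^{(1)}-B^{(k-1)})^{-1}(A^{(1)})^H$, $Q^{(k)}:=Q^{(k-1)}-(A^{(k-1)})^H(Q^{(1)}-B^{(k-1)})^{-1}A^{(k-1)}$. $X_M:=\lim_k Q^{(k)}$ is the maximal positive definite solution of the equation (i.e. $X_M\ge X$ for every Hermitian solution $X$), $Y_M:=\lim_kB^{(k)}$, and $T_1:=(X_M-B^{(1)})^{-1}A^{(1)}$. A sequence $\{X_k\}$ converges R-superlinearly to $X$ with order $r$ if there are $c>0$ and $0<\sigma<1$ with $\|X_{k+1}-X\|<c\,\sigma^{r^k}$ for all positive integers $k$. *)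

theory Defs
  imports "HOL-Analysis.Analysis"
begin

text \<open>
  The scalars are the reals or the complex numbers. The class below has both as instances, and the
  embedding \<open>to_complex\<close> is an isometric homomorphism of real algebras, so its image is a real
  subalgebra of the complex numbers and there are no further models; see
  \<open>range_to_complex\<close>. Heine-Borel holds for both and is included because it carries over to vectors
  and matrices.
\<close>

class real_or_complex = real_normed_field + heine_borel +
  fixes to_complex :: "'a \<Rightarrow> complex"
    and scalar_cnj :: "'a \<Rightarrow> 'a"
  assumes to_complex_add: "to_complex (x + y) = to_complex x + to_complex y"
    and to_complex_mult: "to_complex (x * y) = to_complex x * to_complex y"
    and to_complex_scaleR: "to_complex (t *\<^sub>R x) = t *\<^sub>R to_complex x"
    and norm_to_complex: "norm (to_complex x) = norm x"
    and to_complex_cnj: "to_complex (scalar_cnj x) = cnj (to_complex x)"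

instantiation real :: real_or_complex
begin
definition to_complex_real :: "real \<Rightarrow> complex" where "to_complex_real = complex_of_real"
definition scalar_cnj_real :: "real \<Rightarrow> real" where "scalar_cnj_real x = x"
instance
  by standard (auto simp: to_complex_real_def scalar_cnj_real_def scaleR_conv_of_real)
end

instantiation complex :: real_or_complex
begin
definition to_complex_complex :: "complex \<Rightarrow> complex" where "to_complex_complex z = z"
definition scalar_cnj_complex :: "complex \<Rightarrow> complex" where "scalar_cnj_complex = cnj"
instance
  by standard (auto simp: to_complex_complex_def scalar_cnj_complex_def)
end

lemma to_complex_of_real: "to_complex (of_real t :: 'a::real_or_complex) = of_real t"
proof -
  have "to_complex (1::'a) \<noteq> 0"
    using norm_to_complex[of "1::'a"] by auto
  moreover have "to_complex (1::'a) * to_complex (1::'a) = to_complex (1::'a)"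
    using to_complex_mult[of "1::'a" 1] by (simp only: mult_1_left)
  ultimately have "to_complex (1::'a) = 1"
    by simp
  then show ?thesis
    by (simp add: of_real_def to_complex_scaleR)
qed

lemma range_to_complex:
  "range (to_complex :: 'a::real_or_complex \<Rightarrow> complex) = \<real> \<or>
   range (to_complex :: 'a \<Rightarrow> complex) = UNIV"
proof (rule disjCI)
  assume nU: "range (to_complex :: 'a \<Rightarrow> complex) \<noteq> UNIV"
  have re: "of_real t \<in> range (to_complex :: 'a \<Rightarrow> complex)" for t
    by (metis rangeI to_complex_of_real)
  have "to_complex x \<in> \<real>" for x :: 'a
  proof (rule ccontr)
    assume "to_complex x \<notin> \<real>"
    then have nz: "Im (to_complex x) \<noteq> 0"
      by (simp add: complex_is_Real_iff)
    have "z \<in> range (to_complex :: 'a \<Rightarrow> complex)" for z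
    proof -
      define s where "s = Im z / Im (to_complex x)"
      define t where "t = Re z - s * Re (to_complex x)"
      have "to_complex (of_real t + s *\<^sub>R x) = z"
        unfolding to_complex_add to_complex_of_real to_complex_scaleR
        using nz by (simp add: complex_eq_iff s_def t_def)
      then show ?thesis by (metis rangeI)
    qed
    with nU show False by blast
  qed
  with re show "range (to_complex :: 'a \<Rightarrow> complex) = \<real>"
    by (auto elim: Reals_cases)
qed

definition ctranspose :: "'a::real_or_complex^'n^'m \<Rightarrow> 'a^'m^'n"  ("_\<^sup>H" [1000] 999)
  where "M\<^sup>H = (\<chi> i j. scalar_cnj (M $ j $ i))"

definition hermitian :: "'a::real_or_complex^'n^'n \<Rightarrow> bool"
  where "hermitian M \<longleftrightarrow> M\<^sup>H = M"

definition quad_form :: "'a::real_or_complex^'n^'n \<Rightarrow> 'a^'n \<Rightarrow> 'a"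
  where "quad_form M x = (\<Sum>i\<in>UNIV. scalar_cnj (x $ i) * (M *v x) $ i)"

text \<open>For Hermitian \<open>M\<close> the value \<open>quad_form M x\<close> is real, so taking the real part loses nothing.\<close>

definition pos_def :: "'a::real_or_complex^'n^'n \<Rightarrow> bool"
  where "pos_def M \<longleftrightarrow> hermitian M \<and> (\<forall>x. x \<noteq> 0 \<longrightarrow> 0 < Re (to_complex (quad_form M x)))"

definition pos_semidef :: "'a::real_or_complex^'n^'n \<Rightarrow> bool"
  where "pos_semidef M \<longleftrightarrow> hermitian M \<and> (\<forall>x. 0 \<le> Re (to_complex (quad_form M x)))"

text \<open>Eigenvalues are complex also for a real matrix.\<close>

definition eigenvalues :: "'a::real_or_complex^'n^'n \<Rightarrow> complex set"
  where "eigenvalues M = {l. \<exists>v. v \<noteq> 0 \<and> map_matrix to_complex M *v v = l *s v}"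

definition spec_radius :: "'a::real_or_complex^'n^'n \<Rightarrow> real"
  where "spec_radius M = Max (cmod ` eigenvalues M)"

text \<open>Submultiplicativity is not required, so every matrix norm in the narrower sense is covered.\<close>

definition matrix_norm :: "('a::real_or_complex^'n^'n \<Rightarrow> real) \<Rightarrow> bool"
  where "matrix_norm nrm \<longleftrightarrow>
    (\<forall>M. 0 \<le> nrm M) \<and> (\<forall>M. nrm M = 0 \<longleftrightarrow> M = 0) \<and>
    (\<forall>c M. nrm (map_matrix ((*) c) M) = norm c * nrm M) \<and>
    (\<forall>M N. nrm (M + N) \<le> nrm M + nrm N)"

definition R_superlinear ::
    "('a::real_or_complex^'n^'n \<Rightarrow> real) \<Rightarrow> nat \<Rightarrow> (nat \<Rightarrow> 'a^'n^'n) \<Rightarrow> 'a^'n^'n \<Rightarrow> bool"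
  where "R_superlinear nrm r X L \<longleftrightarrow>
    (\<exists>c \<sigma>. 0 < c \<and> 0 < \<sigma> \<and> \<sigma> < 1 \<and> (\<forall>k\<ge>1. nrm (X (Suc k) - L) < c * \<sigma> ^ (r ^ k)))"

datatype 'm coeffs = Coeffs (A_of: 'm) (B_of: 'm) (Q_of: 'm)

definition plus_init ::
    "('a::real_or_complex^'n^'n \<Rightarrow> 'a^'n^'n) \<Rightarrow> 'a^'n^'n \<Rightarrow> 'a^'n^'n \<Rightarrow> ('a^'n^'n) coeffs"
  where "plus_init f A Q = Coeffs
    (f A ** matrix_inv (f Q) ** A)
    (f A ** matrix_inv (f Q) ** (f A)\<^sup>H)
    (Q - A\<^sup>H ** matrix_inv (f Q) ** A)"

definition minus_init ::
    "('a::real_or_complex^'n^'n \<Rightarrow> 'a^'n^'n) \<Rightarrow> 'a^'n^'n \<Rightarrow> 'a^'n^'n \<Rightarrow> ('a^'n^'n) coeffs"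
  where "minus_init f A Q = Coeffs
    (f A ** matrix_inv (f Q) ** A)
    (- (f A ** matrix_inv (f Q) ** (f A)\<^sup>H))
    (Q + A\<^sup>H ** matrix_inv (f Q) ** A)"

text \<open>
  The update shared by the basic iteration and by the inner loop of the accelerated algorithm:
  \<open>S\<close> is the starting triple of the respective loop and \<open>C\<close> the current one.
\<close>

definition update ::
    "('a::real_or_complex^'n^'n) coeffs \<Rightarrow> ('a^'n^'n) coeffs \<Rightarrow> ('a^'n^'n) coeffs"
  where "update S C = (let W = matrix_inv (Q_of S - B_of C) in Coeffs
    (A_of S ** W ** A_of C)
    (B_of S + A_of S ** W ** (A_of S)\<^sup>H)
    (Q_of C - (A_of C)\<^sup>H ** W ** A_of C))"

text \<open>Both iterations below are indexed from 1; the value at 0 is a dummy.\<close>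

primrec basic_iter ::
    "('a::real_or_complex^'n^'n) coeffs \<Rightarrow> nat \<Rightarrow> ('a^'n^'n) coeffs"
  where
    "basic_iter S 0 = S"
  | "basic_iter S (Suc k) = (if k = 0 then S else update S (basic_iter S k))"

primrec accel_iter ::
    "nat \<Rightarrow> ('a::real_or_complex^'n^'n) coeffs \<Rightarrow> nat \<Rightarrow> ('a^'n^'n) coeffs"
  where
    "accel_iter r S 0 = S"
  | "accel_iter r S (Suc k) = (if k = 0 then S
      else update (accel_iter r S k) (basic_iter (accel_iter r S k) (r - 1)))"

end

theory Submission
  imports Defs "HOL-Computational_Algebra.Fundamental_Theorem_Algebra"
begin

text \<open>
  Attach to a triple \<open>(A, B, Q)\<close> the Hermitian form
  \<open>x\<^sup>H Q x - 2 Re (y\<^sup>H A x) - y\<^sup>H B y\<close> in two variables. Adding the form of \<open>C\<close> in \<open>(x, z)\<close> to that of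
  \<open>D\<close> in \<open>(z, y)\<close> and eliminating \<open>z\<close>, with pivot \<open>Q\<^bsub>D\<^esub> - B\<^bsub>C\<^esub>\<close>, gives the form of \<open>update D C\<close>. The order in
  which several variables are eliminated does not matter, so this composition is associative
  (\<open>update_assoc\<close>). Hence \<open>basic_iter S k\<close> is the \<open>k\<close>-th power of \<open>S\<close>, one accelerated step takes an
  \<open>r\<close>-th power, and the accelerated iterate number \<open>k + 1\<close> is the basic iterate number \<open>r ^ k\<close>
  (\<open>accel_iter_eq_basic_iter\<close>). Superlinear convergence of order \<open>r\<close> is therefore linear convergence
  of the basic iteration, read along \<open>r ^ k\<close> (\<open>superlinear_subsequence\<close>).

  All pivots are positive definite because of one matrix \<open>Z\<close> with
  \<open>B < Z \<le> Q - A\<^sup>H (Z - B)\<^sup>-\<^sup>1 A\<close>. This property passes to compositions (\<open>subsolution_update\<close>), so that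
  \<open>B\<^sub>l < Z \<le> Q\<^sub>k\<close> for all \<open>k\<close> and \<open>l\<close>. It also bounds the decreasing sequence \<open>Q\<^sub>k\<close> and the increasing
  sequence \<open>B\<^sub>k\<close>, which gives the limits and makes \<open>X = lim Q\<^sub>k\<close> a solution of
  \<open>X = Q - A\<^sup>H (X - B)\<^sup>-\<^sup>1 A\<close> (\<open>basic_iter_limits\<close>).

  Put \<open>T = (X - B)\<^sup>-\<^sup>1 A\<close>. Evaluated at the fixed point \<open>X\<close>, the composition law yields
  \<open>A\<^sub>k = (X - B\<^sub>k) T\<^sup>k\<close> and \<open>Q\<^sub>k - X = A\<^sub>k\<^sup>H (X - B\<^sub>k)\<^sup>-\<^sup>1 A\<^sub>k\<close>, while
  \<open>B\<^bsub>k+m\<^esub> - B\<^sub>k = A\<^sub>k (Q\<^sub>k - B\<^sub>m)\<^sup>-\<^sup>1 A\<^sub>k\<^sup>H\<close>. Thus \<open>A\<^sub>k\<close> decays like \<open>T\<^sup>k\<close>, and the other two errors decay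
  like its square as soon as \<open>(X - B\<^sub>k)\<^sup>-\<^sup>1\<close> is bounded, which is where \<open>\<rho>(T) < 1\<close> enters
  (\<open>gap_inverse_bounded\<close>, \<open>basic_iter_rates\<close>). That \<open>T\<^sup>k\<close> is at most a multiple of \<open>s\<^sup>k\<close> for every
  \<open>s > \<rho>(T)\<close> is \<open>matrix_power_growth\<close>.

  The map \<open>f\<close> enters through the starting triple. It preserves positive definiteness, and this makes
  \<open>Q\<close> such a matrix \<open>Z\<close> in the minus case. In the plus case \<open>X\<^sub>S\<close> is such a matrix: there \<open>f\<close> is applied
  to the inequality for \<open>X\<^sub>S\<close>, which contains \<open>A\<^sup>H\<close>, so one needs that \<open>f\<close> commutes with the conjugate
  transpose (\<open>ctranspose_real\<close>, \<open>ctranspose_complex\<close>).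
\<close>

section \<open>Scalars\<close>

lemma to_complex_0 [simp]: "to_complex (0::'a::real_or_complex) = 0"
  using norm_to_complex[of "0::'a"] by simp

lemma to_complex_1 [simp]: "to_complex (1::'a::real_or_complex) = 1"
  using to_complex_of_real[of 1] by simp

lemma to_complex_uminus: "to_complex (- x :: 'a::real_or_complex) = - to_complex x"
  using to_complex_scaleR[of "-1" x] by simp

lemma to_complex_diff: "to_complex (x - y :: 'a::real_or_complex) = to_complex x - to_complex y"
  using to_complex_add[of x "- y"] by (simp add: to_complex_uminus)

lemma to_complex_sum: "to_complex (sum g I :: 'a::real_or_complex) = (\<Sum>i\<in>I. to_complex (g i))"
  by (induction I rule: infinite_finite_induct) (auto simp: to_complex_add)

lemma to_complex_inject [simp]: "to_complex (x::'a::real_or_complex) = to_complex y \<longleftrightarrow> x = y"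
  by (metis eq_iff_diff_eq_0 norm_eq_zero norm_to_complex to_complex_diff)

lemmas to_complex_simps = to_complex_add to_complex_mult to_complex_scaleR to_complex_cnj
  to_complex_uminus to_complex_diff to_complex_sum to_complex_of_real

lemma scalar_cnj_add: "scalar_cnj (x + y :: 'a::real_or_complex) = scalar_cnj x + scalar_cnj y"
  by (rule to_complex_inject[THEN iffD1]) (simp add: to_complex_simps)

lemma scalar_cnj_uminus: "scalar_cnj (- x :: 'a::real_or_complex) = - scalar_cnj x"
  by (rule to_complex_inject[THEN iffD1]) (simp add: to_complex_simps)

lemma scalar_cnj_mult: "scalar_cnj (x * y :: 'a::real_or_complex) = scalar_cnj x * scalar_cnj y"
  by (rule to_complex_inject[THEN iffD1]) (simp add: to_complex_simps)

lemma scalar_cnj_cnj [simp]: "scalar_cnj (scalar_cnj x) = (x :: 'a::real_or_complex)"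
  by (rule to_complex_inject[THEN iffD1]) (simp add: to_complex_simps)

lemma scalar_cnj_0 [simp]: "scalar_cnj 0 = (0 :: 'a::real_or_complex)"
  by (rule to_complex_inject[THEN iffD1]) (simp add: to_complex_simps)

lemma scalar_cnj_1 [simp]: "scalar_cnj 1 = (1 :: 'a::real_or_complex)"
  by (rule to_complex_inject[THEN iffD1]) (simp add: to_complex_simps)

lemma scalar_cnj_sum: "scalar_cnj (sum g I :: 'a::real_or_complex) = (\<Sum>i\<in>I. scalar_cnj (g i))"
  by (induction I rule: infinite_finite_induct) (auto simp: scalar_cnj_add)

lemma norm_scalar_cnj [simp]: "norm (scalar_cnj x) = norm (x :: 'a::real_or_complex)"
  by (metis complex_mod_cnj norm_to_complex to_complex_cnj)

section \<open>Matrix algebra\<close>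

lemma matrix_uminus_left: "(- A) ** B = - (A ** (B :: 'a::real_or_complex^'n^'n))"
  by (simp add: vec_eq_iff matrix_matrix_mult_def sum_negf)

lemma matrix_uminus_right: "A ** (- B) = - (A ** (B :: 'a::real_or_complex^'n^'n))"
  by (simp add: vec_eq_iff matrix_matrix_mult_def sum_negf)

lemma matrix_add_left: "(A + B) ** C = A ** C + B ** (C :: 'a::real_or_complex^'n^'n)"
  by (simp add: vec_eq_iff matrix_matrix_mult_def sum.distrib distrib_right)

lemma matrix_diff_left: "(A - B) ** C = A ** C - B ** (C :: 'a::real_or_complex^'n^'n)"
  by (simp add: vec_eq_iff matrix_matrix_mult_def sum_subtractf left_diff_distrib)

lemma matrix_diff_right: "A ** (B - C) = A ** B - A ** (C :: 'a::real_or_complex^'n^'n)"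
  by (simp add: vec_eq_iff matrix_matrix_mult_def sum_subtractf right_diff_distrib)

lemma matrix_zero_right [simp]: "(A :: 'a::real_or_complex^'n^'n) ** 0 = 0"
  by (simp add: vec_eq_iff matrix_matrix_mult_def)

lemmas mat_ring = matrix_uminus_left matrix_uminus_right matrix_add_left matrix_add_ldistrib
  matrix_diff_left matrix_diff_right matrix_mul_assoc

lemma matrix_inv_right: "invertible (A :: 'a::real_or_complex^'n^'n) \<Longrightarrow> A ** matrix_inv A = mat 1"
  and matrix_inv_left: "invertible (A :: 'a::real_or_complex^'n^'n) \<Longrightarrow> matrix_inv A ** A = mat 1"
  unfolding invertible_def matrix_inv_def by (metis (mono_tags, lifting) someI_ex)+

lemma matrix_inv_cancel:
  fixes A X :: "'a::real_or_complex^'n^'n"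
  assumes "invertible A"
  shows "X ** A ** matrix_inv A = X" "X ** matrix_inv A ** A = X"
  using assms by (simp_all add: matrix_inv_left matrix_inv_right flip: matrix_mul_assoc)

lemma matrix_inv_unique:
  fixes A B :: "'a::real_or_complex^'n^'n"
  assumes "A ** B = mat 1"
  shows "invertible A" "matrix_inv A = B"
proof -
  show inv: "invertible A"
    using assms by (auto simp: invertible_right_inverse)
  have "matrix_inv A ** (A ** B) = B"
    by (simp add: inv matrix_mul_assoc matrix_inv_left)
  then show "matrix_inv A = B"
    by (simp add: assms)
qed

lemma ctranspose_nth: "(M\<^sup>H) $ i $ j = scalar_cnj (M $ j $ i)"
  by (simp add: ctranspose_def)

lemma ctranspose_ctranspose [simp]: "(M\<^sup>H)\<^sup>H = (M :: 'a::real_or_complex^'n^'n)"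
  by (simp add: vec_eq_iff ctranspose_nth)

lemma ctranspose_add: "(M + N)\<^sup>H = M\<^sup>H + (N\<^sup>H :: 'a::real_or_complex^'n^'n)"
  by (simp add: vec_eq_iff ctranspose_nth scalar_cnj_add)

lemma ctranspose_uminus: "(- M)\<^sup>H = - (M\<^sup>H :: 'a::real_or_complex^'n^'n)"
  by (simp add: vec_eq_iff ctranspose_nth scalar_cnj_uminus)

lemma ctranspose_diff: "(M - N)\<^sup>H = M\<^sup>H - (N\<^sup>H :: 'a::real_or_complex^'n^'n)"
  using ctranspose_add[of M "- N"] by (simp add: ctranspose_uminus)

lemma ctranspose_mult: "(M ** N)\<^sup>H = N\<^sup>H ** (M\<^sup>H :: 'a::real_or_complex^'n^'n)"
  by (simp add: vec_eq_iff ctranspose_nth matrix_matrix_mult_def scalar_cnj_sum scalar_cnj_mult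
      mult.commute)

lemma ctranspose_mat: "(mat c :: 'a::real_or_complex^'n^'n)\<^sup>H = mat (scalar_cnj c)"
  by (simp add: vec_eq_iff ctranspose_nth mat_def)

lemmas ctranspose_simps = ctranspose_add ctranspose_uminus ctranspose_diff ctranspose_mult
  ctranspose_mat

lemma ctranspose_matrix_inv:
  fixes M :: "'a::real_or_complex^'n^'n"
  assumes "invertible M"
  shows "invertible (M\<^sup>H)" "matrix_inv (M\<^sup>H) = (matrix_inv M)\<^sup>H"
proof -
  have "M\<^sup>H ** (matrix_inv M)\<^sup>H = mat 1"
    using matrix_inv_left[OF assms] by (simp add: ctranspose_mat flip: ctranspose_mult)
  then show "invertible (M\<^sup>H)" "matrix_inv (M\<^sup>H) = (matrix_inv M)\<^sup>H"
    by (rule matrix_inv_unique)+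
qed

lemma hermitian_matrix_inv: "invertible M \<Longrightarrow> hermitian M \<Longrightarrow> (matrix_inv M)\<^sup>H = matrix_inv M"
  for M :: "'a::real_or_complex^'n^'n"
  unfolding hermitian_def by (metis ctranspose_matrix_inv(2))

lemma hermitianD: "hermitian M \<Longrightarrow> M\<^sup>H = M"
  by (simp add: hermitian_def)

lemma hermitian_add: "hermitian M \<Longrightarrow> hermitian N \<Longrightarrow> hermitian (M + N)"
  and hermitian_diff: "hermitian M \<Longrightarrow> hermitian N \<Longrightarrow> hermitian (M - N)"
  and hermitian_uminus: "hermitian M \<Longrightarrow> hermitian (- M)"
  for M N :: "'a::real_or_complex^'n^'n"
  by (simp_all add: hermitian_def ctranspose_simps)

lemma hermitian_congruence: "hermitian P \<Longrightarrow> hermitian (A\<^sup>H ** P ** A)"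
  and hermitian_congruence': "hermitian P \<Longrightarrow> hermitian (A ** P ** A\<^sup>H)"
  for A P :: "'a::real_or_complex^'n^'n"
  by (simp_all add: hermitian_def ctranspose_simps matrix_mul_assoc)

section \<open>Positive semidefinite matrices\<close>

text \<open>
  Only the real part of the inner product is kept: it is symmetric and bilinear over the reals, and
  still determines adjoints, positivity and the norm. So both scalar fields are treated alike, without
  sesquilinear bookkeeping.
\<close>

definition rip :: "'a::real_or_complex^'n \<Rightarrow> 'a^'n \<Rightarrow> real"
  where "rip x y = (\<Sum>i\<in>UNIV. Re (cnj (to_complex (x $ i)) * to_complex (y $ i)))"

lemma rip_commute: "rip x y = rip y x"
  by (simp add: rip_def mult.commute)

lemma rip_add_left: "rip (x + y) z = rip x z + rip y z"
  unfolding rip_def sum.distrib[symmetric]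
  by (intro sum.cong refl) (simp add: to_complex_simps algebra_simps)

lemma rip_scaleR_left: "rip (t *\<^sub>R x) y = t * rip x y"
  unfolding rip_def sum_distrib_left
  by (intro sum.cong refl) (simp add: to_complex_simps algebra_simps)

lemma rip_uminus_left: "rip (- x) y = - rip x y"
  using rip_scaleR_left[of "-1" x y] by simp

lemma rip_diff_left: "rip (x - y) z = rip x z - rip y z"
  using rip_add_left[of x "- y" z] by (simp add: rip_uminus_left)

lemma rip_add_right: "rip z (x + y) = rip z x + rip z y"
  and rip_scaleR_right: "rip x (t *\<^sub>R y) = t * rip x y"
  and rip_uminus_right: "rip x (- y) = - rip x y"
  and rip_diff_right: "rip z (x - y) = rip z x - rip z y"
  using rip_add_left[of x y z] rip_scaleR_left[of t y x] rip_uminus_left[of y x]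
    rip_diff_left[of x y z]
  by (metis rip_commute)+

lemma rip_zero [simp]: "rip 0 x = 0" "rip x 0 = 0"
  by (simp_all add: rip_def)

lemmas rip_simps = rip_add_left rip_add_right rip_scaleR_left rip_scaleR_right
  rip_uminus_left rip_uminus_right rip_diff_left rip_diff_right

lemma rip_self: "rip x x = (\<Sum>i\<in>UNIV. (norm (x $ i))\<^sup>2)"
  unfolding rip_def
  by (intro sum.cong refl) (metis Re_complex_of_real complex_norm_square mult.commute norm_to_complex)

lemma rip_self_pos: "x \<noteq> 0 \<Longrightarrow> 0 < rip x x"
proof -
  assume "x \<noteq> 0"
  then obtain i where "x $ i \<noteq> 0"
    by (auto simp: vec_eq_iff)
  then show "0 < rip x x"
    unfolding rip_self by (intro sum_pos2[of _ i]) auto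
qed

lemma rip_adjoint: "rip (M *v x) y = rip x (M\<^sup>H *v y)"
proof -
  have "rip (M *v x) y
      = Re (\<Sum>i\<in>UNIV. \<Sum>j\<in>UNIV. cnj (to_complex (M $ i $ j)) * cnj (to_complex (x $ j)) * to_complex (y $ i))"
    by (simp add: rip_def matrix_vector_mult_def to_complex_simps sum_distrib_right)
  also have "\<dots> = Re (\<Sum>j\<in>UNIV. \<Sum>i\<in>UNIV. cnj (to_complex (M $ i $ j)) * cnj (to_complex (x $ j)) * to_complex (y $ i))"
    by (subst sum.swap) rule
  also have "\<dots> = rip x (M\<^sup>H *v y)"
    by (simp add: rip_def matrix_vector_mult_def to_complex_simps sum_distrib_left ctranspose_nth
        algebra_simps)
  finally show ?thesis .
qed

lemma Re_quad_form: "Re (to_complex (quad_form M x)) = rip x (M *v x)"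
  by (simp add: quad_form_def rip_def to_complex_simps)

lemma pos_semidefI: "hermitian M \<Longrightarrow> (\<And>x. 0 \<le> rip x (M *v x)) \<Longrightarrow> pos_semidef M"
  and pos_semidefD: "pos_semidef M \<Longrightarrow> hermitian M" "pos_semidef M \<Longrightarrow> 0 \<le> rip x (M *v x)"
  by (simp_all add: pos_semidef_def Re_quad_form)

lemma pos_defI: "hermitian M \<Longrightarrow> (\<And>x. x \<noteq> 0 \<Longrightarrow> 0 < rip x (M *v x)) \<Longrightarrow> pos_def M"
  and pos_defD: "pos_def M \<Longrightarrow> hermitian M" "pos_def M \<Longrightarrow> x \<noteq> 0 \<Longrightarrow> 0 < rip x (M *v x)"
  by (simp_all add: pos_def_def Re_quad_form)

lemma pos_def_imp_pos_semidef: "pos_def M \<Longrightarrow> pos_semidef M"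
  by (metis less_eq_real_def pos_defD pos_semidefI rip_zero(1))

lemma pos_semidef_add: "pos_semidef M \<Longrightarrow> pos_semidef N \<Longrightarrow> pos_semidef (M + N)"
  by (intro pos_semidefI hermitian_add)
    (simp_all add: pos_semidefD matrix_vector_mult_add_rdistrib rip_simps)

lemma pos_def_add: "pos_def M \<Longrightarrow> pos_semidef N \<Longrightarrow> pos_def (M + N)"
  by (intro pos_defI hermitian_add)
    (simp_all add: pos_semidefD pos_defD matrix_vector_mult_add_rdistrib rip_simps add_pos_nonneg)

lemma pos_semidef_trans: "pos_semidef (M - N) \<Longrightarrow> pos_semidef (N - K) \<Longrightarrow> pos_semidef (M - K)"
  using pos_semidef_add[of "M - N" "N - K"] by simp

lemma pos_def_mono: "pos_def (N - K) \<Longrightarrow> pos_semidef (M - N) \<Longrightarrow> pos_def (M - K)"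
  using pos_def_add[of "N - K" "M - N"] by simp

lemma pos_semidef_0 [simp]: "pos_semidef 0"
  by (rule pos_semidefI) (simp_all add: hermitian_def vec_eq_iff ctranspose_nth)

lemma pos_semidef_congruence: "pos_semidef P \<Longrightarrow> pos_semidef (A\<^sup>H ** P ** A)"
  for A P :: "'a::real_or_complex^'n^'n"
  by (intro pos_semidefI hermitian_congruence)
    (simp_all add: pos_semidefD flip: matrix_vector_mul_assoc rip_adjoint)

lemma pos_def_invertible:
  fixes M :: "'a::real_or_complex^'n^'n"
  assumes "pos_def M"
  shows "invertible M"
proof -
  have "x = 0" if "M *v x = 0" for x
    using pos_defD(2)[OF assms, of x] that by auto
  then show ?thesis
    unfolding invertible_left_inverse matrix_left_invertible_ker by blast
qed

lemma pos_def_matrix_inv: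
  fixes M :: "'a::real_or_complex^'n^'n"
  assumes "pos_def M"
  shows "pos_def (matrix_inv M)"
proof (rule pos_defI)
  have inv: "invertible M"
    by (rule pos_def_invertible[OF assms])
  show "hermitian (matrix_inv M)"
    using hermitian_matrix_inv[OF inv] pos_defD(1)[OF assms] by (simp add: hermitian_def)
  fix x :: "'a^'n" assume "x \<noteq> 0"
  define y where "y = matrix_inv M *v x"
  have x: "M *v y = x"
    by (simp add: y_def matrix_vector_mul_assoc matrix_inv_right[OF inv])
  then have "y \<noteq> 0"
    using \<open>x \<noteq> 0\<close> by auto
  then have "0 < rip y (M *v y)"
    by (rule pos_defD(2)[OF assms])
  then show "0 < rip x (matrix_inv M *v x)"
    by (simp only: x) (simp add: y_def rip_commute)
qed

text \<open>
  Consider the form \<open>x\<^sup>H G x - 2 Re (y\<^sup>H A x) + y\<^sup>H H y\<close>. At \<open>x = G\<^sup>-\<^sup>1 A\<^sup>H y\<close> it is the Schur complement of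
  \<open>G\<close> at \<open>y\<close>; completing the square in \<open>y\<close> instead shows that it is at least the Schur complement of \<open>H\<close>
  at \<open>x\<close>. Positivity of one Schur complement therefore implies positivity of the other.
\<close>

lemma schur_form:
  fixes G H A :: "'a::real_or_complex^'n^'n"
  assumes G: "pos_def G" and H: "pos_def H"
  defines "x \<equiv> \<lambda>y. matrix_inv G *v (A\<^sup>H *v y)"
  shows "rip (x y) ((G - A\<^sup>H ** matrix_inv H ** A) *v x y) \<le> rip y ((H - A ** matrix_inv G ** A\<^sup>H) *v y)"
proof -
  note iG = pos_def_invertible[OF G] and iH = pos_def_invertible[OF H]
  define w where "w = matrix_inv H *v (A *v x y)"
  have Gx: "G *v x y = A\<^sup>H *v y" and Hw: "H *v w = A *v x y"
    by (simp_all add: x_def w_def matrix_vector_mul_assoc matrix_inv_right[OF iG]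
        matrix_inv_right[OF iH] mat_ring)
  have "0 \<le> rip (y - w) (H *v (y - w))"
    by (rule pos_semidefD(2)[OF pos_def_imp_pos_semidef[OF H]])
  also have "\<dots> = rip y (H *v y) - 2 * rip y (A *v x y) + rip w (A *v x y)"
    using rip_adjoint[of H w y] pos_defD(1)[OF H]
    by (simp add: matrix_vector_mult_diff_distrib rip_simps Hw hermitian_def rip_commute)
  finally have "0 \<le> rip y (H *v y) - 2 * rip y (A *v x y) + rip w (A *v x y)" .
  moreover have "rip y (A *v x y) = rip (x y) (G *v x y)"
    by (simp add: Gx rip_commute[of y] rip_adjoint)
  moreover have "rip w (A *v x y) = rip (x y) ((A\<^sup>H ** matrix_inv H ** A) *v x y)"
    by (simp add: w_def rip_commute[of _ "A *v x y"] rip_adjoint flip: matrix_vector_mul_assoc)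
  moreover have "rip y ((A ** matrix_inv G ** A\<^sup>H) *v y) = rip y (A *v x y)"
    by (simp add: x_def flip: matrix_vector_mul_assoc)
  ultimately show ?thesis
    unfolding matrix_vector_mult_diff_rdistrib rip_simps by linarith
qed

lemma schur_pos_semidef:
  fixes G H A :: "'a::real_or_complex^'n^'n"
  assumes G: "pos_def G" and H: "pos_def H" and K: "pos_semidef (G - A\<^sup>H ** matrix_inv H ** A)"
  shows "pos_semidef (H - A ** matrix_inv G ** A\<^sup>H)"
  using schur_form[OF G H, of A] pos_semidefD(2)[OF K] pos_defD(1)[OF H]
    pos_defD(1)[OF pos_def_matrix_inv[OF G]]
  by (intro pos_semidefI hermitian_diff hermitian_congruence') (blast intro: order_trans)+

lemma schur_pos_def:
  fixes G H A :: "'a::real_or_complex^'n^'n"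
  assumes G: "pos_def G" and H: "pos_def H" and K: "pos_def (G - A\<^sup>H ** matrix_inv H ** A)"
  shows "pos_def (H - A ** matrix_inv G ** A\<^sup>H)"
proof (intro pos_defI hermitian_diff hermitian_congruence')
  show "hermitian H" "hermitian (matrix_inv G)"
    using pos_defD(1) H pos_def_matrix_inv[OF G] by blast+
  fix y :: "'a^'n" assume "y \<noteq> 0"
  define x where "x = matrix_inv G *v (A\<^sup>H *v y)"
  show "0 < rip y ((H - A ** matrix_inv G ** A\<^sup>H) *v y)"
  proof (cases "x = 0")
    case True
    then have "(A ** matrix_inv G ** A\<^sup>H) *v y = 0"
      by (simp add: x_def flip: matrix_vector_mul_assoc)
    then show ?thesis
      using pos_defD(2)[OF H \<open>y \<noteq> 0\<close>] by (simp add: matrix_vector_mult_diff_rdistrib)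
  next
    case False
    then show ?thesis
      using schur_form[OF G H, of A y] pos_defD(2)[OF K, of x] by (simp add: x_def)
  qed
qed

text \<open>
  With \<open>A = 1\<close> the two Schur complements of \<open>R\<close> and \<open>P\<^sup>-\<^sup>1\<close> are \<open>R - P\<close> and \<open>P\<^sup>-\<^sup>1 - R\<^sup>-\<^sup>1\<close>.
\<close>

lemma matrix_inv_antimono:
  fixes P R :: "'a::real_or_complex^'n^'n"
  assumes P: "pos_def P" and R: "pos_semidef (R - P)"
  shows "pos_semidef (matrix_inv P - matrix_inv R)"
proof -
  have "pos_def R"
    using pos_def_add[OF P R] by simp
  moreover have "matrix_inv (matrix_inv P) = P"
    by (intro matrix_inv_unique(2) matrix_inv_left pos_def_invertible[OF P])
  ultimately show ?thesis
    using schur_pos_semidef[of R "matrix_inv P" "mat 1"] pos_def_matrix_inv[OF P] R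
    by (simp add: ctranspose_mat)
qed

lemma schur_mono:
  fixes P R A :: "'a::real_or_complex^'n^'n"
  assumes P: "pos_def P" and R: "pos_semidef (R - P)"
  shows "pos_semidef (A\<^sup>H ** matrix_inv P ** A - A\<^sup>H ** matrix_inv R ** A)"
  using pos_semidef_congruence[OF matrix_inv_antimono[OF P R], of A] by (simp add: mat_ring)

text \<open>
  Up to sign, both sides of the first identity are the off-diagonal block of the inverse of
  \<open>((G, A'), (A, H))\<close>, computed by eliminating either diagonal block first. The other two identities
  do the same for the two diagonal blocks.
\<close>

lemma block_inverse:
  fixes G H A A' :: "'a::real_or_complex^'n^'n"
  defines "K \<equiv> G - A' ** matrix_inv H ** A" and "L \<equiv> H - A ** matrix_inv G ** A'"
  assumes iG: "invertible G" and iH: "invertible H" and iK: "invertible K" and iL: "invertible L"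
  shows "matrix_inv L ** A ** matrix_inv G = matrix_inv H ** A ** matrix_inv K"
    and "matrix_inv L = matrix_inv H + matrix_inv H ** A ** matrix_inv K ** A' ** matrix_inv H"
    and "matrix_inv K = matrix_inv G + matrix_inv G ** A' ** matrix_inv L ** A ** matrix_inv G"
proof -
  have "L ** matrix_inv H ** A = A ** matrix_inv G ** K"
    by (simp add: L_def K_def mat_ring matrix_inv_right[OF iH] matrix_inv_cancel[OF iG])
  then have "matrix_inv L ** (L ** matrix_inv H ** A) ** matrix_inv K
      = matrix_inv L ** (A ** matrix_inv G ** K) ** matrix_inv K"
    by simp
  then show off: "matrix_inv L ** A ** matrix_inv G = matrix_inv H ** A ** matrix_inv K"
    by (simp add: matrix_mul_assoc matrix_inv_left[OF iL] matrix_inv_cancel[OF iK])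
  have "matrix_inv H ** A ** matrix_inv K ** A' ** matrix_inv H
      = matrix_inv L ** (A ** matrix_inv G ** A') ** matrix_inv H"
    by (simp add: matrix_mul_assoc flip: off)
  also have "A ** matrix_inv G ** A' = H - L"
    by (simp add: L_def)
  finally show "matrix_inv L = matrix_inv H + matrix_inv H ** A ** matrix_inv K ** A' ** matrix_inv H"
    by (simp add: mat_ring matrix_inv_left[OF iL] matrix_inv_cancel[OF iH])
  have "matrix_inv G ** A' ** matrix_inv L ** A ** matrix_inv G
      = matrix_inv G ** A' ** (matrix_inv L ** A ** matrix_inv G)"
    by (simp add: matrix_mul_assoc)
  also have "\<dots> = matrix_inv G ** (A' ** matrix_inv H ** A) ** matrix_inv K"
    by (simp add: off matrix_mul_assoc)
  also have "A' ** matrix_inv H ** A = G - K"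
    by (simp add: K_def)
  finally show "matrix_inv K = matrix_inv G + matrix_inv G ** A' ** matrix_inv L ** A ** matrix_inv G"
    by (simp add: mat_ring matrix_inv_left[OF iG] matrix_inv_cancel[OF iK])
qed

section \<open>Composition of coefficient triples\<close>

text \<open>
  With a terminal cost \<open>z\<^sup>H X z\<close> added to the form of \<open>C\<close> in \<open>(x, z)\<close>, the optimal \<open>z\<close> is
  \<open>closed_loop C X *v x\<close> and the optimal value is \<open>x\<^sup>H (riccati C X) x\<close>.
\<close>

definition riccati :: "('a::real_or_complex^'n^'n) coeffs \<Rightarrow> 'a^'n^'n \<Rightarrow> 'a^'n^'n"
  where "riccati C X = Q_of C - (A_of C)\<^sup>H ** matrix_inv (X - B_of C) ** A_of C"

definition closed_loop :: "('a::real_or_complex^'n^'n) coeffs \<Rightarrow> 'a^'n^'n \<Rightarrow> 'a^'n^'n"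
  where "closed_loop C X = matrix_inv (X - B_of C) ** A_of C"

text \<open>
  A lower bound of the Riccati map at which all pivots can be compared: for such \<open>Z\<close> the form of \<open>C\<close>
  separates, \<open>B_of C < Z \<le> Q_of C\<close>.
\<close>

definition subsolution :: "'a::real_or_complex^'n^'n \<Rightarrow> ('a^'n^'n) coeffs \<Rightarrow> bool"
  where "subsolution Z C \<longleftrightarrow> hermitian (B_of C) \<and> hermitian (Q_of C) \<and>
    pos_def (Z - B_of C) \<and> pos_semidef (riccati C Z - Z)"

lemma A_of_update: "A_of (update D C) = A_of D ** matrix_inv (Q_of D - B_of C) ** A_of C"
  and B_of_update: "B_of (update D C) = B_of D + A_of D ** matrix_inv (Q_of D - B_of C) ** (A_of D)\<^sup>H"
  and Q_of_update: "Q_of (update D C) = riccati C (Q_of D)"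
  by (simp_all add: update_def Let_def riccati_def)

lemma riccati_mono:
  assumes "pos_def (X - B_of C)" "pos_semidef (Y - X)"
  shows "pos_semidef (riccati C Y - riccati C X)"
  using schur_mono[of "X - B_of C" "Y - B_of C" "A_of C"] assms by (simp add: riccati_def)

lemma riccati_le:
  assumes "pos_def (X - B_of C)"
  shows "pos_semidef (Q_of C - riccati C X)"
  using pos_semidef_congruence[OF pos_def_imp_pos_semidef[OF pos_def_matrix_inv[OF assms]]]
  by (simp add: riccati_def)

text \<open>
  Composing two triples composes their Riccati maps and their optimal transitions. All four claims are
  the same block elimination: \<open>G\<close> and \<open>H\<close> are the pivots of the two inner variables, and the pivots
  left after eliminating the other variable first are the two Schur complements.
\<close>

lemma update_compose:
  assumes G: "pos_def (Q_of D - B_of C)" and H: "pos_def (X - B_of D)"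
    and K: "pos_def (riccati D X - B_of C)"
  shows "pos_def (X - B_of (update D C))"
    and "riccati (update D C) X = riccati C (riccati D X)"
    and "closed_loop (update D C) X = closed_loop D X ** closed_loop C (riccati D X)"
    and "matrix_inv (X - B_of (update D C)) = matrix_inv (X - B_of D)
      + closed_loop D X ** matrix_inv (riccati D X - B_of C) ** (closed_loop D X)\<^sup>H"
proof -
  let ?G = "Q_of D - B_of C" and ?H = "X - B_of D" and ?A = "A_of D"
  have K_eq: "riccati D X - B_of C = ?G - ?A\<^sup>H ** matrix_inv ?H ** ?A"
    by (simp add: riccati_def)
  have L_eq: "X - B_of (update D C) = ?H - ?A ** matrix_inv ?G ** ?A\<^sup>H"
    by (simp add: B_of_update)
  show L: "pos_def (X - B_of (update D C))"
    unfolding L_eq using schur_pos_def[OF G H] K K_eq by simp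
  note block = block_inverse[of ?G ?H "?A\<^sup>H" ?A, folded K_eq L_eq, OF pos_def_invertible[OF G]
      pos_def_invertible[OF H] pos_def_invertible[OF K] pos_def_invertible[OF L]]
  have hG: "(matrix_inv ?G)\<^sup>H = matrix_inv ?G" and hH: "(matrix_inv ?H)\<^sup>H = matrix_inv ?H"
    using pos_def_matrix_inv[OF G] pos_def_matrix_inv[OF H] by (simp_all add: pos_defD hermitianD)
  show "riccati (update D C) X = riccati C (riccati D X)"
    by (simp add: riccati_def[of C] riccati_def[of "update D C"] A_of_update Q_of_update
        ctranspose_simps hG block(3) mat_ring)
  show "closed_loop (update D C) X = closed_loop D X ** closed_loop C (riccati D X)"
    by (simp add: closed_loop_def A_of_update matrix_mul_assoc block(1))
  show "matrix_inv (X - B_of (update D C)) = matrix_inv (X - B_of D)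
      + closed_loop D X ** matrix_inv (riccati D X - B_of C) ** (closed_loop D X)\<^sup>H"
    by (simp add: closed_loop_def ctranspose_simps hH matrix_mul_assoc block(2))
qed

lemma subsolution_Q:
  assumes "subsolution Z C"
  shows "pos_semidef (Q_of C - Z)"
  using assms riccati_le[of Z C] by (auto simp: subsolution_def intro: pos_semidef_trans)

lemma subsolution_gap:
  assumes "subsolution Z C" "subsolution Z D"
  shows "pos_def (Q_of D - B_of C)"
  using assms subsolution_Q by (auto simp: subsolution_def intro: pos_def_mono)

text \<open>
  Applying \<open>riccati C\<close> to \<open>Z \<le> riccati D Z\<close> gives \<open>Z \<le> riccati C Z \<le> riccati C (riccati D Z)\<close> by
  monotonicity; the strict bound on the \<open>B\<close>-part is the Schur complement flip of \<open>update_compose\<close>.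
\<close>

lemma subsolution_update:
  assumes C: "subsolution Z C" and D: "subsolution Z D"
  shows "subsolution Z (update D C)"
proof -
  note G = subsolution_gap[OF C D]
  have H: "pos_def (Z - B_of D)" and RD: "pos_semidef (riccati D Z - Z)"
    and BC: "pos_def (Z - B_of C)" and RC: "pos_semidef (riccati C Z - Z)"
    using C D by (auto simp: subsolution_def)
  note K = pos_def_mono[OF BC RD]
  note L = update_compose(1,2)[OF G H K]
  have "pos_semidef (riccati C (riccati D Z) - Z)"
    using pos_semidef_trans[OF riccati_mono[OF BC RD] RC] .
  moreover have "hermitian (B_of (update D C))"
    using D pos_def_matrix_inv[OF G]
    by (auto simp: B_of_update subsolution_def pos_defD intro!: hermitian_add hermitian_congruence')
  moreover have "hermitian (Q_of (update D C))"
    unfolding Q_of_update riccati_def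
    using C pos_def_matrix_inv[OF G]
    by (intro hermitian_diff hermitian_congruence) (auto simp: subsolution_def pos_defD)
  ultimately show ?thesis
    using L by (simp add: subsolution_def)
qed

text \<open>
  The terminal cost \<open>Q_of E\<close> turns the composition rules for \<open>D\<close> after \<open>C\<close> into the three components of
  associativity.
\<close>

lemma update_assoc:
  assumes C: "subsolution Z C" and D: "subsolution Z D" and E: "subsolution Z E"
  shows "update (update E D) C = update E (update D C)"
proof -
  let ?G = "Q_of D - B_of C" and ?H = "Q_of E - B_of D" and ?A = "A_of D"
  note G = subsolution_gap[OF C D] and H = subsolution_gap[OF D E]
  have K: "pos_def (riccati D (Q_of E) - B_of C)"
    using subsolution_gap[OF C subsolution_update[OF D E]] by (simp add: Q_of_update)
  note comp = update_compose[OF G H K]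
  have hH: "(matrix_inv ?H)\<^sup>H = matrix_inv ?H"
    using pos_def_matrix_inv[OF H] by (simp add: pos_defD hermitianD)
  show ?thesis
  proof (rule coeffs.expand, intro conjI)
    show "A_of (update (update E D) C) = A_of (update E (update D C))"
      using comp(3) by (simp add: A_of_update Q_of_update closed_loop_def flip: matrix_mul_assoc)
    show "B_of (update (update E D) C) = B_of (update E (update D C))"
      unfolding B_of_update[of "update E D"] B_of_update[of E]
      by (simp add: A_of_update Q_of_update comp(4) closed_loop_def ctranspose_simps hH mat_ring)
    show "Q_of (update (update E D) C) = Q_of (update E (update D C))"
      by (simp add: Q_of_update comp(2))
  qed
qed

lemma subsolution_basic_iter: "subsolution Z S \<Longrightarrow> subsolution Z (basic_iter S k)"
  by (induction k) (auto intro: subsolution_update)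

lemma basic_iter_add:
  assumes S: "subsolution Z S" and "0 < m" "0 < k"
  shows "basic_iter S (m + k) = update (basic_iter S m) (basic_iter S k)"
  using \<open>0 < m\<close>
proof (induction m rule: nat_induct_non_zero)
  case 1
  then show ?case using \<open>0 < k\<close> by simp
next
  case (Suc m)
  then show ?case
    using update_assoc[OF subsolution_basic_iter[OF S, of k] subsolution_basic_iter[OF S, of m] S]
    by simp
qed

lemma basic_iter_basic_iter:
  assumes S: "subsolution Z S" and "0 < m" "0 < k"
  shows "basic_iter (basic_iter S m) k = basic_iter S (m * k)"
  using \<open>0 < k\<close>
proof (induction k rule: nat_induct_non_zero)
  case 1
  then show ?case by simp
next
  case (Suc k)
  then show ?case
    using basic_iter_add[OF S \<open>0 < m\<close>, of "m * k"] \<open>0 < m\<close> by simp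
qed

lemma accel_iter_eq_basic_iter:
  assumes S: "subsolution Z S" and "1 < r"
  shows "accel_iter r S (Suc k) = basic_iter S (r ^ k)"
proof (induction k)
  case 0
  then show ?case by simp
next
  case (Suc k)
  have "accel_iter r S (Suc (Suc k)) = update (basic_iter S (r ^ k)) (basic_iter S (r ^ k * (r - 1)))"
    using Suc basic_iter_basic_iter[OF S, of "r ^ k" "r - 1"] \<open>1 < r\<close> by simp
  also have "\<dots> = basic_iter S (r ^ k + r ^ k * (r - 1))"
    by (rule basic_iter_add[OF S, symmetric]) (use \<open>1 < r\<close> in auto)
  also have "r ^ k + r ^ k * (r - 1) = r ^ Suc k"
    using \<open>1 < r\<close> by (cases r) auto
  finally show ?case .
qed

section \<open>Norms and limits of matrices\<close>

text \<open>
  This norm is submultiplicative and invariant under the conjugate transpose, and it dominates every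
  matrix norm up to a constant, which is all that upper bounds for an arbitrary norm need.
\<close>

definition entry_norm :: "'a::real_or_complex^'n^'n \<Rightarrow> real"
  where "entry_norm M = (\<Sum>i\<in>UNIV. \<Sum>j\<in>UNIV. norm (M $ i $ j))"

lemma entry_norm_nonneg [simp]: "0 \<le> entry_norm M"
  by (simp add: entry_norm_def sum_nonneg)

lemma entry_norm_0 [simp]: "entry_norm 0 = 0"
  by (simp add: entry_norm_def)

lemma entry_norm_add: "entry_norm (M + N) \<le> entry_norm M + entry_norm N"
  unfolding entry_norm_def sum.distrib[symmetric]
  by (intro sum_mono) (simp add: norm_triangle_ineq)

lemma entry_norm_mult: "entry_norm (M ** N) \<le> entry_norm M * entry_norm N"
proof -
  have "entry_norm (M ** N) \<le> (\<Sum>i\<in>UNIV. \<Sum>j\<in>UNIV. \<Sum>k\<in>UNIV. norm (M $ i $ k) * norm (N $ k $ j))"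
    unfolding entry_norm_def matrix_matrix_mult_def
    by (intro sum_mono) (simp add: sum_norm_le norm_mult)
  also have "\<dots> = (\<Sum>i\<in>UNIV. \<Sum>k\<in>UNIV. norm (M $ i $ k) * (\<Sum>j\<in>UNIV. norm (N $ k $ j)))"
    unfolding sum_distrib_left by (rule sum.cong[OF refl]) (rule sum.swap)
  also have "\<dots> \<le> (\<Sum>i\<in>UNIV. \<Sum>k\<in>UNIV. norm (M $ i $ k) * entry_norm N)"
    unfolding entry_norm_def
    by (intro sum_mono mult_left_mono member_le_sum[where f = "\<lambda>k. \<Sum>j\<in>UNIV. norm (N $ k $ j)"] sum_nonneg) auto
  also have "\<dots> = entry_norm M * entry_norm N"
    by (simp add: entry_norm_def[of M] sum_distrib_right)
  finally show ?thesis .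
qed

lemma entry_norm_mult_le:
  assumes "entry_norm M \<le> a" "entry_norm N \<le> b"
  shows "entry_norm (M ** N) \<le> a * b"
  using entry_norm_mult[of M N] mult_mono[OF assms] entry_norm_nonneg[of M] assms(1)
  by (smt (verit) entry_norm_nonneg)

lemma entry_norm_ctranspose [simp]: "entry_norm (M\<^sup>H) = entry_norm M"
  unfolding entry_norm_def by (subst sum.swap) (simp add: ctranspose_nth)

lemma norm_le_entry_norm: "norm M \<le> entry_norm M"
proof -
  have "norm M \<le> (\<Sum>i\<in>UNIV. norm (M $ i))"
    unfolding norm_vec_def[of M] by (rule L2_set_le_sum) simp
  also have "\<dots> \<le> entry_norm M"
    unfolding entry_norm_def norm_vec_def[of "M $ i" for i]
    by (intro sum_mono L2_set_le_sum) simp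
  finally show ?thesis .
qed

definition elem_matrix :: "'n \<Rightarrow> 'n \<Rightarrow> 'a::real_or_complex \<Rightarrow> 'a^'n^'n"
  where "elem_matrix i j c = (\<chi> k l. if k = i \<and> l = j then c else 0)"

lemma elem_matrix_expansion: "M = (\<Sum>i\<in>UNIV. \<Sum>j\<in>UNIV. elem_matrix i j (M $ i $ j))"
proof -
  have "(\<Sum>j\<in>UNIV. elem_matrix i j (M $ i $ j) $ k $ l) = (if k = i then M $ i $ l else 0)" for i k l
    by (cases "k = i") (simp_all add: elem_matrix_def)
  then show ?thesis
    by (simp add: vec_eq_iff)
qed

lemma matrix_norm_le_entry_norm:
  fixes nrm :: "'a::real_or_complex^'n^'n \<Rightarrow> real"
  assumes "matrix_norm nrm"
  obtains c where "0 < c" "\<And>M. nrm M \<le> c * entry_norm M"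
proof -
  define c where "c = 1 + (\<Sum>i\<in>UNIV. \<Sum>j\<in>UNIV. nrm (elem_matrix i j 1))"
  have nonneg: "0 \<le> nrm M" and zero: "nrm 0 = 0"
    and scale: "nrm (map_matrix ((*) a) M) = norm a * nrm M"
    and triangle: "nrm (M + N) \<le> nrm M + nrm N" for a M N
    using assms by (auto simp: matrix_norm_def)
  have sum_le: "nrm (sum g I) \<le> (\<Sum>i\<in>I. nrm (g i))" for g and I :: "'n set"
  proof (induction I rule: infinite_finite_induct)
    case (insert i I)
    then show ?case
      using triangle[of "g i" "sum g I"] by simp
  qed (simp_all add: zero)
  have elem_le: "nrm (elem_matrix i j a) \<le> norm a * c" for i j a
  proof -
    have "nrm (elem_matrix i j 1) \<le> (\<Sum>j\<in>UNIV. nrm (elem_matrix i j 1))"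
      by (rule member_le_sum) (auto simp: nonneg)
    also have "\<dots> \<le> (\<Sum>i\<in>UNIV. \<Sum>j\<in>UNIV. nrm (elem_matrix i j 1))"
      by (rule member_le_sum) (auto simp: nonneg sum_nonneg)
    finally have "nrm (elem_matrix i j 1) \<le> c"
      by (simp add: c_def)
    moreover have "elem_matrix i j a = map_matrix ((*) a) (elem_matrix i j 1)"
      by (simp add: vec_eq_iff elem_matrix_def)
    ultimately show ?thesis
      by (simp add: scale mult_left_mono)
  qed
  have "nrm M \<le> c * entry_norm M" for M
  proof -
    have "nrm M \<le> (\<Sum>i\<in>UNIV. \<Sum>j\<in>UNIV. nrm (elem_matrix i j (M $ i $ j)))"
      by (subst elem_matrix_expansion) (rule order_trans[OF sum_le sum_mono[OF sum_le]])
    also have "\<dots> \<le> (\<Sum>i\<in>UNIV. \<Sum>j\<in>UNIV. norm (M $ i $ j) * c)"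
      by (intro sum_mono elem_le)
    also have "\<dots> = c * entry_norm M"
      by (simp add: entry_norm_def sum_distrib_left mult.commute)
    finally show ?thesis .
  qed
  moreover have "0 < c"
    by (simp add: c_def add_pos_nonneg sum_nonneg nonneg)
  ultimately show thesis
    using that by blast
qed

text \<open>
  On positive semidefinite matrices the trace is equivalent to a norm. It is linear and monotone, so
  it reduces monotone convergence of matrices to monotone convergence of real numbers.
\<close>

definition retrace :: "'a::real_or_complex^'n^'n \<Rightarrow> real"
  where "retrace M = (\<Sum>i\<in>UNIV. Re (to_complex (M $ i $ i)))"

lemma retrace_diff: "retrace (M - N) = retrace M - retrace N"
  by (simp add: retrace_def to_complex_simps sum_subtractf)

lemma retrace_le_entry_norm: "retrace M \<le> entry_norm M"
  unfolding retrace_def entry_norm_def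
proof (rule sum_mono)
  fix i
  have "Re (to_complex (M $ i $ i)) \<le> norm (M $ i $ i)"
    by (metis complex_Re_le_cmod norm_to_complex)
  also have "\<dots> \<le> (\<Sum>j\<in>UNIV. norm (M $ i $ j))"
    by (rule member_le_sum) auto
  finally show "Re (to_complex (M $ i $ i)) \<le> (\<Sum>j\<in>UNIV. norm (M $ i $ j))" .
qed

lemma rip_axis: "rip (axis i u) w = Re (cnj (to_complex u) * to_complex (w $ i))"
proof -
  have "rip (axis i u) w = (\<Sum>k\<in>UNIV. if k = i then Re (cnj (to_complex u) * to_complex (w $ k)) else 0)"
    unfolding rip_def by (intro sum.cong refl) (auto simp: axis_def)
  then show ?thesis by simp
qed

lemma matrix_vector_mult_axis: "(M *v axis j v) $ i = M $ i $ j * (v :: 'a::real_or_complex)"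
proof -
  have "(M *v axis j v) $ i = (\<Sum>k\<in>UNIV. if k = j then M $ i $ k * v else 0)"
    by (simp add: matrix_vector_mult_def axis_def if_distrib cong: if_cong)
  then show ?thesis by simp
qed

lemma pos_semidef_arith_mean:
  assumes "pos_semidef M"
  shows "2 * rip y (M *v x) \<le> rip x (M *v x) + rip y (M *v y)"
proof -
  have "rip x (M *v y) = rip y (M *v x)"
    using rip_adjoint[of M x y] pos_semidefD(1)[OF assms] by (simp add: hermitian_def rip_commute)
  then show ?thesis
    using pos_semidefD(2)[OF assms, of "x - y"]
    by (simp add: matrix_vector_mult_diff_distrib rip_simps)
qed

text \<open>
  The form is nonnegative at \<open>u e\<^sub>i - e\<^sub>j\<close>, where the unit scalar \<open>u\<close> is the phase of the entry.
\<close>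

lemma pos_semidef_entry_le:
  assumes M: "pos_semidef M"
  shows "2 * norm (M $ i $ j) \<le> Re (to_complex (M $ i $ i)) + Re (to_complex (M $ j $ j))"
proof (cases "M $ i $ j = 0")
  case True
  have "0 \<le> Re (to_complex (M $ k $ k))" for k
    using pos_semidefD(2)[OF M, of "axis k 1"] by (simp add: rip_axis matrix_vector_mult_axis)
  then show ?thesis
    using True by simp
next
  case False
  define z where "z = to_complex (M $ i $ j)"
  define u where "u = (1 / norm z) *\<^sub>R M $ i $ j"
  have z: "z \<noteq> 0" "norm z = norm (M $ i $ j)"
    using False norm_to_complex[of "M $ i $ j"] by (auto simp: z_def)
  have u: "to_complex u = z /\<^sub>R norm z"
    by (simp add: u_def to_complex_simps z_def divide_inverse)
  have sq: "cnj z * z = complex_of_real ((norm z)\<^sup>2)"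
    by (metis complex_norm_square mult.commute)
  have 1: "cnj (to_complex u) * z = complex_of_real (norm z)"
    using z(1) by (simp add: u scaleR_conv_of_real mult.assoc sq) (simp add: power2_eq_square)
  have 2: "cnj (to_complex u) * to_complex u = 1"
    using z(1) 1 by (simp add: u scaleR_conv_of_real field_simps)
  have "rip (axis i u) (M *v axis j 1) = norm z"
    by (simp add: rip_axis matrix_vector_mult_axis 1 flip: z_def)
  moreover have "rip (axis i u) (M *v axis i u) = Re (to_complex (M $ i $ i) * (cnj (to_complex u) * to_complex u))"
    by (simp add: rip_axis matrix_vector_mult_axis to_complex_simps algebra_simps)
  moreover have "rip (axis j 1) (M *v axis j 1) = Re (to_complex (M $ j $ j))"
    by (simp add: rip_axis matrix_vector_mult_axis)
  ultimately show ?thesis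
    using pos_semidef_arith_mean[OF M, of "axis i u" "axis j 1"] by (simp add: z 2)
qed

lemma pos_semidef_entry_norm_le:
  fixes M :: "'a::real_or_complex^'n^'n"
  assumes "pos_semidef M"
  shows "entry_norm M \<le> real CARD('n) * retrace M"
proof -
  have "2 * entry_norm M \<le> (\<Sum>i\<in>UNIV. \<Sum>j\<in>UNIV. Re (to_complex (M $ i $ i)) + Re (to_complex (M $ j $ j)))"
    unfolding entry_norm_def sum_distrib_left
    by (intro sum_mono) (rule pos_semidef_entry_le[OF assms])
  also have "\<dots> = 2 * (real CARD('n) * retrace M)"
    by (simp add: sum.distrib retrace_def sum_distrib_left)
  finally show ?thesis by simp
qed

lemma pos_semidef_retrace_nonneg: "pos_semidef M \<Longrightarrow> 0 \<le> retrace M"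
  for M :: "'a::real_or_complex^'n^'n"
  using pos_semidef_entry_norm_le[of M] entry_norm_nonneg[of M]
  by (smt (verit) of_nat_0_less_iff zero_less_card_finite mult_pos_neg)

lemma pos_semidef_entry_norm_mono:
  fixes M N :: "'a::real_or_complex^'n^'n"
  assumes "pos_semidef M" "pos_semidef (N - M)"
  shows "entry_norm M \<le> real CARD('n) * entry_norm N"
proof -
  have "retrace M \<le> entry_norm N"
    using pos_semidef_retrace_nonneg[OF assms(2)] retrace_le_entry_norm[of N]
    by (simp add: retrace_diff)
  then show ?thesis
    using pos_semidef_entry_norm_le[OF assms(1)]
    by (meson mult_left_mono of_nat_0_le_iff order_trans)
qed

lemma tendsto_entry_norm:
  assumes "(\<lambda>k. entry_norm (M k - L)) \<longlonglongrightarrow> 0"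
  shows "M \<longlonglongrightarrow> L"
proof -
  have "(\<lambda>k. M k - L) \<longlonglongrightarrow> 0"
    by (rule Lim_null_comparison[OF _ assms]) (simp add: norm_le_entry_norm)
  then show ?thesis
    by (rule LIM_zero_cancel)
qed

lemma entry_norm_tendsto: "M \<longlonglongrightarrow> L \<Longrightarrow> (\<lambda>k. entry_norm (M k)) \<longlonglongrightarrow> entry_norm L"
  unfolding entry_norm_def by (intro tendsto_intros)

lemma tendsto_matrix_mult:
  fixes M N :: "nat \<Rightarrow> 'a::real_or_complex^'n^'n"
  assumes "M \<longlonglongrightarrow> K" "N \<longlonglongrightarrow> L"
  shows "(\<lambda>k. M k ** N k) \<longlonglongrightarrow> K ** L"
  unfolding matrix_matrix_mult_def by (intro tendsto_intros assms)

lemma tendsto_to_complex: "g \<longlonglongrightarrow> l \<Longrightarrow> (\<lambda>k. to_complex (g k)) \<longlonglongrightarrow> to_complex l"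
  by (simp add: tendsto_iff dist_norm norm_to_complex flip: to_complex_diff)

lemma tendsto_ctranspose:
  fixes M :: "nat \<Rightarrow> 'a::real_or_complex^'n^'n"
  assumes "M \<longlonglongrightarrow> L"
  shows "(\<lambda>k. (M k)\<^sup>H) \<longlonglongrightarrow> L\<^sup>H"
proof (rule tendsto_entry_norm)
  have "(\<lambda>k. entry_norm (M k - L)) \<longlonglongrightarrow> 0"
    using entry_norm_tendsto[OF tendsto_diff[OF assms tendsto_const[of L]]] by simp
  then show "(\<lambda>k. entry_norm ((M k)\<^sup>H - L\<^sup>H)) \<longlonglongrightarrow> 0"
    by (simp flip: ctranspose_diff)
qed

lemma pos_semidef_limit:
  fixes M :: "nat \<Rightarrow> 'a::real_or_complex^'n^'n"
  assumes "M \<longlonglongrightarrow> L" "eventually (\<lambda>k. pos_semidef (M k)) sequentially"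
  shows "pos_semidef L"
proof (rule pos_semidefI)
  have "eventually (\<lambda>k. (M k)\<^sup>H = M k) sequentially"
    using assms(2) by eventually_elim (simp add: pos_semidefD hermitianD)
  then have "M \<longlonglongrightarrow> L\<^sup>H"
    using tendsto_ctranspose[OF assms(1)] by (rule Lim_transform_eventually[rotated])
  then show "hermitian L"
    using assms(1) unfolding hermitian_def by (rule LIMSEQ_unique)
  fix x :: "'a^'n"
  have "(\<lambda>k. rip x (M k *v x)) \<longlonglongrightarrow> rip x (L *v x)"
    unfolding rip_def matrix_vector_mult_def
    by (intro tendsto_intros tendsto_to_complex assms(1))
  then show "0 \<le> rip x (L *v x)"
    by (rule tendsto_lowerbound)
      (use assms(2) in \<open>auto elim: eventually_mono simp: pos_semidefD\<close>)
qed

text \<open>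
  The traces decrease and are bounded below, hence form a Cauchy sequence; since the differences are
  positive semidefinite, their norms are at most a multiple of the trace differences.
\<close>

lemma pos_semidef_decreasing_convergent:
  fixes M :: "nat \<Rightarrow> 'a::real_or_complex^'n^'n"
  assumes dec: "\<And>k. pos_semidef (M k - M (Suc k))" and bdd: "\<And>k. pos_semidef (M k - Z)"
  obtains L where "M \<longlonglongrightarrow> L" "pos_semidef (L - Z)" "\<And>k. pos_semidef (M k - L)"
proof -
  let ?c = "real CARD('n)" and ?t = "\<lambda>k. retrace (M k)"
  have dec': "pos_semidef (M k - M l)" if "k \<le> l" for k l
    using that
  proof (induction l rule: dec_induct)
    case (step l)
    then show ?case using pos_semidef_trans[OF _ dec] by blast
  qed simp
  have "decseq ?t"
    using pos_semidef_retrace_nonneg[OF dec] by (simp add: decseq_Suc_iff retrace_diff)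
  moreover have "retrace Z \<le> ?t k" for k
    using pos_semidef_retrace_nonneg[OF bdd, of k] by (simp add: retrace_diff)
  ultimately have "convergent ?t"
    by (metis decseq_convergent convergent_def)
  then have "Cauchy (\<lambda>k. ?c * ?t k)"
    using convergent_Cauchy convergent_mult[OF convergent_const] by blast
  have "Cauchy M"
  proof (rule CauchyI)
    fix e :: real assume "0 < e"
    then obtain K where K: "\<And>m n. K \<le> m \<Longrightarrow> K \<le> n \<Longrightarrow> norm (?c * ?t m - ?c * ?t n) < e"
      using CauchyD[OF \<open>Cauchy (\<lambda>k. ?c * ?t k)\<close>] by blast
    have "norm (M m - M n) < e" if "K \<le> m" "m \<le> n" for m n
    proof -
      have "norm (M m - M n) \<le> ?c * retrace (M m - M n)"
        using norm_le_entry_norm pos_semidef_entry_norm_le[OF dec'[OF \<open>m \<le> n\<close>]] by (rule order_trans)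
      also have "\<dots> \<le> norm (?c * ?t m - ?c * ?t n)"
        by (simp add: retrace_diff right_diff_distrib)
      also have "\<dots> < e"
        using K that by simp
      finally show ?thesis .
    qed
    then show "\<exists>K. \<forall>m\<ge>K. \<forall>n\<ge>K. norm (M m - M n) < e"
      by (metis nle_le norm_minus_commute)
  qed
  then obtain L where L: "M \<longlonglongrightarrow> L"
    using Cauchy_convergent convergent_def by blast
  show thesis
  proof (rule that[OF L])
    show "pos_semidef (L - Z)"
      by (rule pos_semidef_limit[of "\<lambda>k. M k - Z"]) (auto intro!: tendsto_intros L simp: bdd)
    show "pos_semidef (M k - L)" for k
      by (rule pos_semidef_limit[of "\<lambda>l. M k - M l"])
        (auto intro!: tendsto_intros L dec' eventually_sequentiallyI[of k])
  qed
qed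

lemma tendsto_matrix_inv_from_above:
  fixes P :: "nat \<Rightarrow> 'a::real_or_complex^'n^'n"
  assumes lim: "P \<longlonglongrightarrow> L" and L: "pos_def L" and above: "\<And>k. pos_semidef (P k - L)"
  shows "(\<lambda>k. matrix_inv (P k)) \<longlonglongrightarrow> matrix_inv L"
proof (rule tendsto_entry_norm, rule Lim_null_comparison)
  let ?c = "real CARD('n) * entry_norm (matrix_inv L)"
  have P: "pos_def (P k)" for k
    using pos_def_add[OF L above[of k]] by simp
  have inv_le: "entry_norm (matrix_inv (P k)) \<le> ?c" for k
    by (intro pos_semidef_entry_norm_mono pos_def_imp_pos_semidef pos_def_matrix_inv P
        matrix_inv_antimono L above)
  have "matrix_inv (P k) - matrix_inv L = matrix_inv (P k) ** (L - P k) ** matrix_inv L" for k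
    by (simp add: mat_ring matrix_inv_left pos_def_invertible P matrix_inv_cancel L)
  then have "entry_norm (matrix_inv (P k) - matrix_inv L)
      \<le> ?c * entry_norm (L - P k) * entry_norm (matrix_inv L)" for k
    using inv_le by (simp add: entry_norm_mult_le)
  then show "\<forall>\<^sub>F k in sequentially. norm (entry_norm (matrix_inv (P k) - matrix_inv L))
      \<le> ?c * entry_norm (L - P k) * entry_norm (matrix_inv L)"
    by simp
  have "(\<lambda>k. entry_norm (L - P k)) \<longlonglongrightarrow> 0"
    using entry_norm_tendsto[OF tendsto_diff[OF tendsto_const[of L] lim]] by simp
  from tendsto_mult[OF tendsto_mult[OF tendsto_const[of ?c] this] tendsto_const[of "entry_norm (matrix_inv L)"]]
  show "(\<lambda>k. ?c * entry_norm (L - P k) * entry_norm (matrix_inv L)) \<longlonglongrightarrow> 0"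
    by simp
qed

section \<open>Growth of matrix powers\<close>

text \<open>
  The vector \<open>p(N) x\<close>, by Horner's scheme.
\<close>

definition poly_apply :: "complex^'n^'n \<Rightarrow> complex poly \<Rightarrow> complex^'n \<Rightarrow> complex^'n"
  where "poly_apply N p x = fold_coeffs (\<lambda>a y. a *s x + N *v y) p 0"

lemma poly_apply_0 [simp]: "poly_apply N 0 x = 0"
  by (simp add: poly_apply_def)

lemma poly_apply_pCons [simp]: "poly_apply N (pCons a p) x = a *s x + N *v poly_apply N p x"
  by (cases "p = 0"; cases "a = 0") (simp_all add: poly_apply_def)

lemma poly_apply_add: "poly_apply N (p + q) x = poly_apply N p x + poly_apply N q x"
  by (induction p q rule: poly_induct2)
    (simp_all add: matrix_vector_right_distrib vector_sadd_rdistrib)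

lemma poly_apply_smult: "poly_apply N (smult c p) x = c *s poly_apply N p x"
  by (induction p)
    (simp_all add: vector_smult_assoc vector_add_ldistrib vector_scalar_commute)

lemma poly_apply_mult: "poly_apply N (p * q) x = poly_apply N p (poly_apply N q x)"
  by (induction p) (simp_all add: poly_apply_add poly_apply_smult)

lemma poly_apply_zero_vec [simp]: "poly_apply N p 0 = 0"
  by (induction p) simp_all

lemma poly_apply_add_vec: "poly_apply N p (x + y) = poly_apply N p x + poly_apply N p y"
  by (induction p) (simp_all add: matrix_vector_right_distrib vector_add_ldistrib)

lemma poly_apply_smult_vec: "poly_apply N p (c *s x) = c *s poly_apply N p x"
  by (induction p)
    (simp_all add: vector_smult_assoc vector_add_ldistrib vector_scalar_commute mult.commute)

lemma poly_apply_sum_vec: "poly_apply N p (sum g I) = (\<Sum>i\<in>I. poly_apply N p (g i))"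
  by (induction I rule: infinite_finite_induct) (simp_all add: poly_apply_add_vec)

lemma poly_apply_sum: "poly_apply N (sum g I) x = (\<Sum>i\<in>I. poly_apply N (g i) x)"
  by (induction I rule: infinite_finite_induct) (simp_all add: poly_apply_add)

lemma poly_apply_monom: "poly_apply N (monom c i) x = c *s (((*v) N) ^^ i) x"
  by (induction i) (simp_all add: monom_0 monom_Suc vector_scalar_commute)

lemma poly_apply_eigenvector: "N *v x = l *s x \<Longrightarrow> poly_apply N p x = poly p l *s x"
  by (induction p)
    (simp_all add: vector_scalar_commute vector_smult_assoc vector_sadd_rdistrib mult.commute)

text \<open>
  The \<open>n + 1\<close> vectors \<open>x, N x, \<dots>, N\<^sup>n x\<close> either repeat or are linearly dependent.
\<close>

lemma annihilating_poly_vec: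
  fixes N :: "complex^'n^'n"
  shows "\<exists>p. p \<noteq> 0 \<and> poly_apply N p x = 0"
proof -
  let ?v = "\<lambda>i. (((*v) N) ^^ i) x" and ?I = "{..CARD('n)}"
  show ?thesis
  proof (cases "inj_on ?v ?I")
    case False
    then obtain i j where ij: "i \<noteq> j" "?v i = ?v j"
      by (auto simp: inj_on_def)
    have "coeff (monom 1 i + monom (- 1) j) i \<noteq> (0 :: complex)"
      using ij(1) by simp
    then have "monom 1 i + monom (- 1) j \<noteq> (0 :: complex poly)"
      by (metis coeff_0)
    moreover have "poly_apply N (monom 1 i + monom (- 1) j) x = 0"
      by (simp add: poly_apply_add poly_apply_monom ij(2))
    ultimately show ?thesis by blast
  next
    case True
    then have "card (?v ` ?I) = CARD('n) + 1"
      by (simp add: card_image)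
    then have "vec.dependent (?v ` ?I)"
      using vec.independent_card_le_dim[of "?v ` ?I" UNIV] vec_dim_card[where 'a = complex and 'n = 'n] by force
    then obtain u w where u: "w \<in> ?v ` ?I" "u w \<noteq> 0" "(\<Sum>y\<in>?v ` ?I. u y *s y) = 0"
      using vec.dependent_finite[of "?v ` ?I"] by auto
    define p where "p = (\<Sum>i\<in>?I. monom (u (?v i)) i)"
    obtain i where i: "i \<in> ?I" "w = ?v i"
      using u(1) by auto
    have "coeff p i = u w"
      using i by (simp add: p_def coeff_sum)
    then have "p \<noteq> 0"
      using u(2) by auto
    moreover have "poly_apply N p x = 0"
      using u(3) by (simp add: p_def poly_apply_sum poly_apply_monom sum.reindex[OF True])
    ultimately show ?thesis by blast
  qed
qed

lemma annihilating_poly: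
  fixes N :: "complex^'n^'n"
  obtains p where "p \<noteq> 0" "\<And>x. poly_apply N p x = 0"
proof -
  have "\<exists>p. p \<noteq> 0 \<and> (\<forall>i\<in>I. poly_apply N p (axis i 1) = 0)" if "finite I" for I :: "'n set"
    using that
  proof (induction I)
    case empty
    then show ?case by (intro exI[of _ 1]) simp
  next
    case (insert i I)
    then obtain p where p: "p \<noteq> 0" "\<forall>i\<in>I. poly_apply N p (axis i 1) = 0"
      by blast
    obtain q where q: "q \<noteq> 0" "poly_apply N q (axis i 1) = 0"
      using annihilating_poly_vec by blast
    have "poly_apply N (p * q) (axis j 1) = 0" if "j \<in> insert i I" for j
    proof (cases "j = i")
      case True
      then show ?thesis by (simp add: poly_apply_mult q)
    next
      case False
      then show ?thesis
        using that p by (simp add: mult.commute[of p] poly_apply_mult)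
    qed
    then show ?case
      using p q by (intro exI[of _ "p * q"]) simp
  qed
  then obtain p where p: "p \<noteq> 0" "\<forall>i. poly_apply N p (axis i 1) = 0"
    by (metis UNIV_I finite_class.finite_UNIV)
  have "poly_apply N p x = 0" for x
    by (subst basis_expansion[symmetric]) (simp add: poly_apply_sum_vec poly_apply_smult_vec p)
  then show thesis
    using that p by blast
qed

lemma finite_eigenvalues: "finite (eigenvalues M)"
proof -
  obtain p where p: "p \<noteq> 0" "\<And>x. poly_apply (map_matrix to_complex M) p x = 0"
    using annihilating_poly by blast
  have "eigenvalues M \<subseteq> {l. poly p l = 0}"
  proof
    fix l assume "l \<in> eigenvalues M"
    then obtain v where "v \<noteq> 0" "map_matrix to_complex M *v v = l *s v"
      by (auto simp: eigenvalues_def)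
    then show "l \<in> {l. poly p l = 0}"
      using p(2)[of v] by (simp add: poly_apply_eigenvector)
  qed
  then show ?thesis
    using poly_roots_finite[OF p(1)] by (rule finite_subset)
qed

text \<open>
  Splitting off the linear factors of an annihilating polynomial reduces any vector to \<open>0\<close> by finitely
  many maps \<open>x \<mapsto> N x - l x\<close>. This replaces the Jordan normal form in the growth estimate.
\<close>

lemma shift_induct:
  fixes N :: "complex^'n^'n"
  assumes zero: "P 0" and step: "\<And>l x. P (N *v x - l *s x) \<Longrightarrow> P x"
  shows "P x"
proof -
  have "P x" if "p \<noteq> 0" "poly_apply N p x = 0" for p
    using that
  proof (induction "degree p" arbitrary: p x rule: less_induct)
    case less
    show ?case
    proof (cases "degree p = 0")
      case True
      then obtain a where "p = [:a:]"
        by (metis degree_eq_zeroE)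
      then show ?thesis
        using less.prems zero by simp
    next
      case False
      then have "\<not> constant (poly p)"
        by (simp add: constant_degree)
      then obtain l where "poly p l = 0"
        using fundamental_theorem_of_algebra by blast
      then obtain q where q: "p = q * [:- l, 1:]"
        by (metis dvdE mult.commute poly_eq_0_iff_dvd)
      then have "q \<noteq> 0"
        using less.prems(1) by auto
      moreover have "degree p = degree q + degree [:- l, 1:]"
        unfolding q by (rule degree_mult_eq) (use \<open>q \<noteq> 0\<close> in auto)
      then have "degree q < degree p"
        by simp
      moreover have "poly_apply N [:- l, 1:] x = N *v x - l *s x"
        by (simp add: vector_smult_lneg)
      then have "poly_apply N q (N *v x - l *s x) = 0"
        using less.prems(2) unfolding q poly_apply_mult by simp
      ultimately show ?thesis
        using less.hyps step by blast
    qed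
  qed
  then show ?thesis
    using annihilating_poly_vec by blast
qed

lemma norm_smult_vec: "norm (c *s x) = norm c * norm (x :: complex^'n)"
  by (simp add: norm_vec_def norm_mult L2_set_right_distrib)

lemma not_eigenvalue_inverse:
  fixes N :: "complex^'n^'n"
  assumes "\<not> (\<exists>v. v \<noteq> 0 \<and> N *v v = l *s v)"
  obtains R where "\<And>x. R *v (N *v x - l *s x) = x"
proof -
  have shift: "(N - mat l) *v x = N *v x - l *s x" for x
  proof -
    have "mat l *v x = l *s x"
      by (simp add: vec_eq_iff matrix_vector_mult_def mat_def if_distrib if_distribR cong: if_cong)
    then show ?thesis
      by (simp add: matrix_vector_mult_diff_rdistrib)
  qed
  obtain R where "R ** (N - mat l) = mat 1"
    using matrix_left_invertible_ker[of "N - mat l"] assms shift by auto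
  then show thesis
    using that[of R] by (metis shift matrix_vector_mul_assoc matrix_vector_mul_lid)
qed

text \<open>
  Without eigenvalues all maps \<open>x \<mapsto> M x - l x\<close> are injective, which forces every vector to be \<open>0\<close>.
\<close>

lemma eigenvalues_nonempty: "eigenvalues M \<noteq> {}"
proof
  assume none: "eigenvalues M = {}"
  have "x = 0" for x :: "complex^'b"
  proof (induction x rule: shift_induct[where N = "map_matrix to_complex M"])
    case (2 l x)
    then show ?case
      using none by (auto simp: eigenvalues_def)
  qed simp
  then have "axis undefined 1 = (0 :: complex^'b)"
    by blast
  then show False
    by simp
qed

lemma eigenvalue_le_spec_radius: "l \<in> eigenvalues M \<Longrightarrow> cmod l \<le> spec_radius M"
  by (simp add: spec_radius_def finite_eigenvalues)

lemma spec_radius_nonneg: "0 \<le> spec_radius M"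
  using eigenvalues_nonempty[of M] eigenvalue_le_spec_radius
  by (metis all_not_in_conv norm_ge_zero order_trans)

primrec matrix_power :: "'a::real_or_complex^'n^'n \<Rightarrow> nat \<Rightarrow> 'a^'n^'n"
  where
    "matrix_power T 0 = mat 1"
  | "matrix_power T (Suc k) = T ** matrix_power T k"

lemma matrix_power_entry:
  "to_complex (matrix_power T k $ i $ j) = ((((*v) (map_matrix to_complex T)) ^^ k) (axis j 1)) $ i"
proof (induction k arbitrary: i)
  case 0
  then show ?case by (simp add: mat_def axis_def)
next
  case (Suc k)
  show ?case
    by (simp add: matrix_matrix_mult_def to_complex_simps Suc)
      (simp add: matrix_vector_mult_def)
qed

text \<open>
  The bound for the orbit of \<open>N x - l x\<close> passes to the orbit of \<open>x\<close>: if \<open>\<bar>l\<bar> < s\<close>, by solving the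
  recursion \<open>u\<^bsub>k+1\<^esub> = l u\<^sub>k + w\<^sub>k\<close>, and otherwise \<open>l\<close> is no eigenvalue, so that \<open>N - l\<close> can be inverted.
\<close>

lemma vector_orbit_growth:
  fixes N :: "complex^'n^'n"
  assumes "0 < s" and eig: "\<And>l v. v \<noteq> 0 \<Longrightarrow> N *v v = l *s v \<Longrightarrow> cmod l < s"
  shows "\<exists>C. \<forall>k. norm ((((*v) N) ^^ k) x) \<le> C * s ^ k"
proof (induction x rule: shift_induct[where N = N])
  case 1
  have "(((*v) N) ^^ k) 0 = 0" for k
    by (induction k) auto
  then show ?case by (intro exI[of _ 0]) simp
next
  case (2 l x)
  let ?u = "\<lambda>k. (((*v) N) ^^ k) x"
  have shift: "(((*v) N) ^^ k) (N *v x - l *s x) = N *v ?u k - l *s ?u k" for k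
    by (induction k) (simp_all add: matrix_vector_mult_diff_distrib vector_scalar_commute)
  obtain C where C: "\<And>k. norm (N *v ?u k - l *s ?u k) \<le> C * s ^ k"
    using 2 shift by auto
  show ?case
  proof (cases "cmod l < s")
    case True
    \<comment> \<open>Chosen so that \<open>norm x \<le> D\<close> and \<open>cmod l * D + C \<le> D * s\<close>.\<close>
    define D where "D = norm x + C / (s - cmod l)"
    have "0 \<le> C"
      using order_trans[OF norm_ge_zero C[of 0]] by simp
    have "D * (s - cmod l) = norm x * (s - cmod l) + C"
      using True by (simp add: D_def distrib_right)
    moreover have "0 \<le> norm x * (s - cmod l)"
      using True by simp
    ultimately have D: "cmod l * D + C \<le> D * s"
      by (simp add: algebra_simps)
    have "norm (?u k) \<le> D * s ^ k" for k
    proof (induction k)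
      case 0
      then show ?case using True \<open>0 \<le> C\<close> by (simp add: D_def)
    next
      case (Suc k)
      have "norm (?u (Suc k)) = norm (l *s ?u k + (N *v ?u k - l *s ?u k))"
        by simp
      also have "\<dots> \<le> cmod l * (D * s ^ k) + C * s ^ k"
        using Suc C[of k]
        by (intro order_trans[OF norm_triangle_ineq] add_mono) (simp_all add: norm_smult_vec mult_left_mono)
      also have "\<dots> = (cmod l * D + C) * s ^ k"
        by (simp add: algebra_simps)
      also have "\<dots> \<le> D * s * s ^ k"
        using D \<open>0 < s\<close> by (intro mult_right_mono) auto
      finally show ?case by (simp add: mult_ac)
    qed
    then show ?thesis by blast
  next
    case False
    then obtain R where R: "\<And>x. R *v (N *v x - l *s x) = x"
      using not_eigenvalue_inverse[of N l] eig by blast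
    obtain K where "0 \<le> K" and K: "\<And>y. norm (R *v y) \<le> norm y * K"
      using bounded_linear.nonneg_bounded[OF matrix_vector_mul_bounded_linear[of R]] by blast
    have "norm (?u k) \<le> (C * K) * s ^ k" for k
    proof -
      have "norm (?u k) \<le> norm (N *v ?u k - l *s ?u k) * K"
        using K R by metis
      also have "\<dots> \<le> C * s ^ k * K"
        using C \<open>0 \<le> K\<close> by (intro mult_right_mono)
      finally show ?thesis by (simp add: mult_ac)
    qed
    then show ?thesis by blast
  qed
qed

lemma matrix_power_growth:
  fixes T :: "'a::real_or_complex^'n^'n"
  assumes "spec_radius T < s"
  obtains C where "0 < C" "\<And>k. entry_norm (matrix_power T k) \<le> C * s ^ k"
proof -
  let ?N = "map_matrix to_complex T"
  have "0 < s"
    using spec_radius_nonneg[of T] assms by linarith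
  moreover have "cmod l < s" if "v \<noteq> 0" "?N *v v = l *s v" for l v
    using eigenvalue_le_spec_radius[of l T] that assms by (force simp: eigenvalues_def)
  ultimately have "\<exists>C. \<forall>k. norm ((((*v) ?N) ^^ k) (axis j 1)) \<le> C * s ^ k" for j
    by (rule vector_orbit_growth)
  then obtain C where C: "\<And>j k. norm ((((*v) ?N) ^^ k) (axis j 1)) \<le> C j * s ^ k"
    by metis
  define D where "D = 1 + (\<Sum>i\<in>(UNIV :: 'n set). \<Sum>j\<in>(UNIV :: 'n set). C j)"
  have "0 \<le> C j" for j
    using order_trans[OF norm_ge_zero C[of 0 j]] by simp
  then have "0 < D"
    unfolding D_def by (intro add_pos_nonneg sum_nonneg) auto
  moreover have "entry_norm (matrix_power T k) \<le> D * s ^ k" for k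
  proof -
    have "entry_norm (matrix_power T k) \<le> (\<Sum>i\<in>(UNIV :: 'n set). \<Sum>j\<in>UNIV. C j * s ^ k)"
      unfolding entry_norm_def
    proof (intro sum_mono)
      fix i j :: 'n
      have "norm (matrix_power T k $ i $ j) = norm (((((*v) ?N) ^^ k) (axis j 1)) $ i)"
        by (metis matrix_power_entry norm_to_complex)
      also have "\<dots> \<le> norm ((((*v) ?N) ^^ k) (axis j 1))"
        by (rule Finite_Cartesian_Product.norm_nth_le)
      finally show "norm (matrix_power T k $ i $ j) \<le> C j * s ^ k"
        using C[of k j] by linarith
    qed
    also have "\<dots> = (D - 1) * s ^ k"
      by (simp add: D_def sum_distrib_right sum_distrib_left mult.assoc)
    also have "\<dots> \<le> D * s ^ k"
      using \<open>0 < s\<close> by (simp add: mult_right_mono)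
    finally show ?thesis .
  qed
  ultimately show thesis
    using that by blast
qed

section \<open>Positive multiplicative involutions\<close>

lemma matrix_vector_mult_scaleR_right:
  "M *v (t *\<^sub>R x) = t *\<^sub>R (M *v x)" for M :: "'a::real_or_complex^'n^'n"
  by (simp add: vec_eq_iff matrix_vector_mult_def scaleR_sum_right)

text \<open>
  Otherwise the form would become negative at \<open>x - t M x\<close> for small \<open>t > 0\<close>.
\<close>

lemma pos_semidef_kernel:
  fixes M :: "'a::real_or_complex^'n^'n"
  assumes M: "pos_semidef M" and "rip x (M *v x) = 0"
  shows "M *v x = 0"
proof (rule ccontr)
  assume nz: "M *v x \<noteq> 0"
  define y where "y = M *v x"
  have "0 < rip y y"
    using rip_self_pos[OF nz] by (simp add: y_def)
  have le: "2 * t * rip y y \<le> t\<^sup>2 * rip y (M *v y)" for t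
    using pos_semidef_arith_mean[OF M, of "t *\<^sub>R y" x] assms(2)
    by (simp add: rip_simps matrix_vector_mult_scaleR_right power2_eq_square flip: y_def)
  define q where "q = rip y (M *v y)"
  have "0 \<le> q"
    unfolding q_def by (rule pos_semidefD(2)[OF M])
  \<comment> \<open>The divisor \<open>q + 1\<close> instead of \<open>q\<close> also covers \<open>q = 0\<close>.\<close>
  define t where "t = rip y y / (q + 1)"
  have "0 < t" and "t * (q + 1) = rip y y"
    using \<open>0 < rip y y\<close> \<open>0 \<le> q\<close> by (auto simp: t_def)
  have "2 * rip y y \<le> t * q"
    using le[of t] \<open>0 < t\<close> by (simp add: power2_eq_square flip: q_def)
  also have "\<dots> \<le> t * (q + 1)"
    using \<open>0 < t\<close> by simp
  finally show False
    using \<open>t * (q + 1) = rip y y\<close> \<open>0 < rip y y\<close> by simp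
qed

lemma pos_semidef_invertible_pos_def:
  fixes M :: "'a::real_or_complex^'n^'n"
  assumes M: "pos_semidef M" and "invertible M"
  shows "pos_def M"
proof (rule pos_defI)
  show "hermitian M"
    using M by (rule pos_semidefD)
  fix x :: "'a^'n" assume "x \<noteq> 0"
  moreover have "x = 0" if "M *v x = 0"
    using \<open>invertible M\<close> that unfolding invertible_left_inverse matrix_left_invertible_ker by blast
  ultimately have "rip x (M *v x) \<noteq> 0"
    using pos_semidef_kernel[OF M] by blast
  then show "0 < rip x (M *v x)"
    using pos_semidefD(2)[OF M, of x] by linarith
qed

lemma mat_of_real_vec: "mat (of_real c) *v x = c *\<^sub>R (x :: 'a::real_or_complex^'n)"
proof -
  have "(mat (of_real c) *v x) $ i = (\<Sum>j\<in>UNIV. if i = j then of_real c * x $ j else 0)" for i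
    unfolding matrix_vector_mult_def mat_def vec_lambda_beta by (intro sum.cong refl) simp
  then show ?thesis
    by (simp add: vec_eq_iff scaleR_conv_of_real[where 'a = 'a])
qed

lemma hermitian_mat_of_real: "hermitian (mat (of_real c) :: 'a::real_or_complex^'n^'n)"
proof -
  have "scalar_cnj (of_real c :: 'a) = of_real c"
    by (rule to_complex_inject[THEN iffD1]) (simp add: to_complex_simps)
  then show ?thesis
    by (simp add: hermitian_def ctranspose_mat)
qed

lemma pos_semidef_mat_of_real: "0 \<le> c \<Longrightarrow> pos_semidef (mat (of_real c) :: 'a::real_or_complex^'n^'n)"
  by (intro pos_semidefI hermitian_mat_of_real)
    (simp add: mat_of_real_vec rip_simps rip_self sum_nonneg)

lemma pos_def_mat_1: "pos_def (mat 1 :: 'a::real_or_complex^'n^'n)"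
  using hermitian_mat_of_real[of 1] by (intro pos_defI) (simp_all add: rip_self_pos)

lemma hermitian_shift_pos_semidef:
  fixes H :: "'a::real_or_complex^'n^'n"
  assumes H: "hermitian H"
  shows "pos_semidef (H + mat (of_real (entry_norm H)))"
proof (intro pos_semidefI hermitian_add H hermitian_mat_of_real)
  fix x :: "'a^'n"
  have nx: "(norm (x $ i))\<^sup>2 \<le> rip x x" for i
    unfolding rip_self by (rule member_le_sum) auto
  have "norm (x $ i) * norm (x $ j) \<le> rip x x" for i j
    using nx[of i] nx[of j] sum_squares_bound[of "norm (x $ i)" "norm (x $ j)"] by simp
  then have entry: "- (norm (H $ i $ j) * rip x x)
      \<le> Re (cnj (to_complex (x $ i)) * to_complex (H $ i $ j * x $ j))" for i j
  proof -
    have "\<bar>Re (cnj (to_complex (x $ i)) * to_complex (H $ i $ j * x $ j))\<bar>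
        \<le> norm (H $ i $ j) * (norm (x $ i) * norm (x $ j))"
      using abs_Re_le_cmod[of "cnj (to_complex (x $ i)) * to_complex (H $ i $ j * x $ j)"]
      by (simp add: norm_mult norm_to_complex mult_ac)
    also have "\<dots> \<le> norm (H $ i $ j) * rip x x"
      using \<open>\<And>i j. norm (x $ i) * norm (x $ j) \<le> rip x x\<close> by (simp add: mult_left_mono)
    finally show ?thesis by linarith
  qed
  have "- (entry_norm H * rip x x) = (\<Sum>i\<in>UNIV. \<Sum>j\<in>UNIV. - (norm (H $ i $ j) * rip x x))"
    by (simp add: entry_norm_def sum_distrib_right sum_negf)
  also have "\<dots> \<le> (\<Sum>i\<in>UNIV. \<Sum>j\<in>UNIV. Re (cnj (to_complex (x $ i)) * to_complex (H $ i $ j * x $ j)))"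
    by (intro sum_mono entry)
  also have "\<dots> = rip x (H *v x)"
    by (simp add: rip_def matrix_vector_mult_def to_complex_sum sum_distrib_left)
  finally show "0 \<le> rip x ((H + mat (of_real (entry_norm H))) *v x)"
    by (simp add: matrix_vector_mult_add_rdistrib mat_of_real_vec rip_simps)
qed

lemma mat_central: "mat c ** M = M ** (mat c :: 'a::real_or_complex^'n^'n)"
proof -
  have "(mat c ** M) $ i $ j = (\<Sum>k\<in>UNIV. if i = k then c * M $ k $ j else 0)" for i j
    unfolding matrix_matrix_mult_def mat_def vec_lambda_beta by (intro sum.cong refl) simp
  moreover have "(M ** mat c) $ i $ j = (\<Sum>k\<in>UNIV. if k = j then M $ i $ k * c else 0)" for i j
    unfolding matrix_matrix_mult_def mat_def vec_lambda_beta by (intro sum.cong refl) simp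
  ultimately show ?thesis
    by (simp add: vec_eq_iff mult.commute)
qed

lemma mat_uminus: "mat (- c) = - (mat c :: 'a::real_or_complex^'n^'n)"
  by (simp add: vec_eq_iff mat_def)

lemma mat_mult: "mat c ** mat d = (mat (c * d) :: 'a::real_or_complex^'n^'n)"
proof -
  have "(mat c ** mat d :: 'a^'n^'n) $ k $ l = (\<Sum>m\<in>UNIV. if m = k then (if k = l then c * d else 0) else 0)" for k l
    unfolding matrix_matrix_mult_def mat_def vec_lambda_beta by (intro sum.cong refl) auto
  then show ?thesis
    by (simp add: vec_eq_iff mat_def)
qed

lemma matrix_double_cancel: "M + M = N + N \<Longrightarrow> M = (N :: 'a::real_or_complex^'n^'n)"
  by (metis scaleR_2 scaleR_cancel_left zero_neq_numeral)

locale positive_involution =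
  fixes f :: "'a::real_or_complex^'n^'n \<Rightarrow> 'a^'n^'n"
  assumes invol: "f (f M) = M"
    and add: "f (M + N) = f M + f N"
    and mult: "f (M ** N) = f M ** f N"
    and pos: "pos_semidef M \<Longrightarrow> pos_semidef (f M)"
begin

lemma zero: "f 0 = 0"
  using add[of 0 0] by simp

lemma uminus: "f (- M) = - f M"
  using add[of M "- M"] by (simp add: zero eq_neg_iff_add_eq_0 add.commute)

lemma diff: "f (M - N) = f M - f N"
  using add[of M "- N"] by (simp add: uminus)

lemma one: "f (mat 1) = mat 1"
proof -
  have "f (f (mat 1) ** mat 1) = f (mat 1)"
    using mult[of "f (mat 1)" "mat 1"] by (simp add: invol)
  then show ?thesis
    by (metis invol matrix_mul_rid)
qed

lemma inverse:
  assumes "invertible M"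
  shows "invertible (f M)" "matrix_inv (f M) = f (matrix_inv M)"
proof -
  have "f M ** f (matrix_inv M) = mat 1"
    by (simp add: matrix_inv_right[OF assms] one flip: mult)
  then show "invertible (f M)" "matrix_inv (f M) = f (matrix_inv M)"
    by (rule matrix_inv_unique)+
qed

lemma pos_def: "pos_def M \<Longrightarrow> pos_def (f M)"
  using pos_semidef_invertible_pos_def[OF pos[OF pos_def_imp_pos_semidef]] inverse(1)[OF pos_def_invertible]
  by blast

text \<open>
  A Hermitian matrix becomes positive semidefinite after adding a multiple of the identity, and
  positive semidefinite matrices are mapped to positive semidefinite, hence Hermitian, ones.
\<close>

lemma hermitian:
  assumes "hermitian M"
  shows "hermitian (f M)"
proof -
  let ?c = "mat (of_real (entry_norm M))"
  have "f M = f (M + ?c) - f ?c"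
    by (simp add: add)
  moreover have "hermitian (f (M + ?c))" "hermitian (f ?c)"
    using pos hermitian_shift_pos_semidef[OF assms] pos_semidef_mat_of_real pos_semidefD(1)
      entry_norm_nonneg by blast+
  ultimately show ?thesis
    by (simp add: hermitian_diff)
qed

text \<open>
  The identity holds for Hermitian matrices and is inherited by sums and products. Over the reals an
  off-diagonal matrix unit is a product of two symmetric matrices,
  \<open>E\<^bsub>ij\<^esub> = E\<^bsub>ii\<^esub> (E\<^bsub>ij\<^esub> + E\<^bsub>ji\<^esub>)\<close>, so these matrices generate everything.
\<close>

lemma ctranspose_real:
  assumes real: "\<And>c :: 'a. scalar_cnj c = c"
  shows "f (M\<^sup>H) = (f M)\<^sup>H"
proof -
  let ?good = "\<lambda>M. f (M\<^sup>H) = (f M)\<^sup>H"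
  have good_herm: "?good M" if "hermitian M" for M
    using that hermitian[OF that] by (simp add: hermitian_def)
  have good_mult: "?good (M ** N)" if "?good M" "?good N" for M N
    using that by (simp add: ctranspose_mult mult)
  have good_sum: "?good (sum g I)" if "\<And>i. ?good (g i)" for g and I :: "'n set"
  proof (induction I rule: infinite_finite_induct)
    case (insert i I)
    then show ?case
      using that by (simp add: ctranspose_add add)
  qed (simp_all add: zero good_herm pos_semidefD)
  have "?good (elem_matrix i j c)" for i j c
  proof (cases "i = j")
    case True
    then have "hermitian (elem_matrix i j c)"
      by (auto simp: hermitian_def vec_eq_iff ctranspose_nth elem_matrix_def real)
    then show ?thesis by (rule good_herm)
  next
    case False
    have sym: "(elem_matrix a b d)\<^sup>H = elem_matrix b a d" for a b :: 'n and d :: 'a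
      by (simp add: vec_eq_iff ctranspose_nth elem_matrix_def real conj_commute)
    have "hermitian (elem_matrix i i 1 :: 'a^'n^'n)" "hermitian (elem_matrix i j c + elem_matrix j i c)"
      by (simp_all add: hermitian_def ctranspose_add sym add.commute)
    then have "?good (elem_matrix i i 1 ** (elem_matrix i j c + elem_matrix j i c))"
      by (rule good_mult[OF good_herm good_herm])
    also have "elem_matrix i i 1 ** (elem_matrix i j c + elem_matrix j i c) = elem_matrix i j c"
    proof -
      have "(elem_matrix i i 1 ** (elem_matrix i j c + elem_matrix j i c)) $ k $ l
          = (\<Sum>m\<in>UNIV. if m = i then (if k = i \<and> l = j then c else 0) else 0)" for k l
        unfolding matrix_matrix_mult_def vec_lambda_beta
        using False by (intro sum.cong refl) (auto simp: elem_matrix_def)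
      then show ?thesis
        by (simp add: vec_eq_iff elem_matrix_def)
    qed
    finally show ?thesis .
  qed
  then have "?good (\<Sum>i\<in>UNIV. \<Sum>j\<in>UNIV. elem_matrix i j (M $ i $ j))"
    by (rule good_sum[OF good_sum])
  then show ?thesis
    by (simp only: elem_matrix_expansion[of M, symmetric])
qed

text \<open>
  Every matrix is \<open>H + \<i> K\<close> with Hermitian \<open>H\<close> and \<open>K\<close>, so it suffices that \<open>J = f(\<i>)\<close> is
  skew-Hermitian. As \<open>J\<close> is central with \<open>J\<^sup>2 = -1\<close>, the positive semidefinite matrix \<open>J\<^sup>H J\<close> has square
  \<open>1\<close> and hence equals \<open>1\<close>; multiplying by \<open>J\<close> gives \<open>J\<^sup>H = -J\<close>.
\<close>

lemma ctranspose_complex: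
  assumes i: "to_complex (\<iota> :: 'a) = \<i>"
  shows "f (M\<^sup>H) = (f M)\<^sup>H"
proof -
  have cnj: "scalar_cnj \<iota> = - \<iota>" and sq: "\<iota> * \<iota> = - 1"
    by (rule to_complex_inject[THEN iffD1], simp add: to_complex_simps i)+
  define J where "J = f (mat \<iota>)"
  have II: "mat \<iota> ** mat \<iota> = - (mat 1 :: 'a^'n^'n)"
    by (simp add: mat_mult sq mat_uminus)
  have JJ: "J ** J = - mat 1"
    unfolding J_def mult[symmetric] by (simp add: II uminus one)
  have J_central: "J ** N = N ** J" for N
    using mat_central[of \<iota> "f N"] invol[of N] by (metis J_def mult)
  define P where "P = J\<^sup>H ** J"
  have P: "pos_semidef P"
    unfolding P_def using pos_semidef_congruence[OF pos_def_imp_pos_semidef[OF pos_def_mat_1], of J] by simp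
  have "P ** P = (J\<^sup>H ** J\<^sup>H) ** (J ** J)"
    unfolding P_def using J_central[of "J\<^sup>H"] by (metis matrix_mul_assoc)
  also have "J\<^sup>H ** J\<^sup>H = - mat 1"
    using arg_cong[OF JJ, of ctranspose] by (simp add: ctranspose_simps)
  finally have "(mat 1 + P) ** (P - mat 1) = 0"
    by (simp add: JJ mat_ring)
  moreover have inv: "invertible (mat 1 + P)"
    by (intro pos_def_invertible pos_def_add pos_def_mat_1 P)
  ultimately have "matrix_inv (mat 1 + P) ** (mat 1 + P) ** (P - mat 1) = 0"
    by (simp flip: matrix_mul_assoc)
  then have "P = mat 1"
    by (simp add: matrix_inv_left[OF inv])
  then have "J\<^sup>H ** J = mat 1"
    by (simp add: P_def)
  moreover have "- (J\<^sup>H ** J ** J) = J\<^sup>H"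
    unfolding matrix_mul_assoc[symmetric] JJ by (simp add: matrix_uminus_right)
  ultimately have J_skew: "J\<^sup>H = - J"
    by simp
  define H where "H = M + M\<^sup>H"
  define K where "K = - (mat \<iota> ** (M - M\<^sup>H))"
  have "hermitian H"
    by (simp add: H_def hermitian_def ctranspose_simps add.commute)
  have "hermitian K"
    by (simp add: K_def hermitian_def ctranspose_simps cnj mat_uminus mat_ring
        mat_central[of \<iota> M] mat_central[of \<iota> "M\<^sup>H"])
  have iK: "mat \<iota> ** K = M - M\<^sup>H"
    by (simp add: K_def mat_ring II)
  have M2: "M + M = H + mat \<iota> ** K" and M2': "M\<^sup>H + M\<^sup>H = H - mat \<iota> ** K"
    by (simp_all add: iK H_def)
  have "(f M)\<^sup>H + (f M)\<^sup>H = (f H + J ** f K)\<^sup>H"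
    unfolding ctranspose_add[symmetric] add[symmetric] M2 by (simp add: add mult J_def)
  also have "\<dots> = f H - J ** f K"
    using hermitian[OF \<open>hermitian H\<close>] hermitian[OF \<open>hermitian K\<close>] J_central[of "f K"]
    by (simp add: hermitian_def ctranspose_simps J_skew mat_ring)
  also have "\<dots> = f (M\<^sup>H) + f (M\<^sup>H)"
    unfolding add[symmetric] M2' by (simp add: diff mult J_def)
  finally show ?thesis
    by (rule matrix_double_cancel[symmetric])
qed

lemma ctranspose: "f (M\<^sup>H) = (f M)\<^sup>H"
  using range_to_complex[where 'a = 'a]
proof
  assume "range (to_complex :: 'a \<Rightarrow> complex) = \<real>"
  then have "cnj (to_complex c) = to_complex c" for c :: 'a
    by (metis Reals_cnj_iff rangeI)
  then show ?thesis
    by (intro ctranspose_real) (metis to_complex_cnj to_complex_inject)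
next
  assume "range (to_complex :: 'a \<Rightarrow> complex) = UNIV"
  then obtain \<iota> :: 'a where "to_complex \<iota> = \<i>"
    by (metis UNIV_I imageE)
  then show ?thesis
    by (rule ctranspose_complex)
qed

text \<open>
  Applying \<open>f\<close> to the inequality for \<open>X\<close> gives \<open>K = f(Q) - f(A)\<^sup>H X\<^sup>-\<^sup>1 f(A) \<ge> f(X) > 0\<close>. The other Schur
  complement \<open>L\<close> is the gap \<open>X - B\<close> of the starting triple, and the formula for \<open>K\<^sup>-\<^sup>1\<close> in terms of
  \<open>L\<^sup>-\<^sup>1\<close> turns its Riccati value at \<open>X\<close> into \<open>Q - A\<^sup>H K\<^sup>-\<^sup>1 A \<ge> Q - A\<^sup>H f(X)\<^sup>-\<^sup>1 A \<ge> X\<close>.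
\<close>

lemma plus_init_subsolution:
  assumes Q: "hermitian Q" and X: "pos_def X"
    and sub: "pos_semidef ((Q - A\<^sup>H ** matrix_inv (f X) ** A) - X)"
  shows "invertible (f Q)" "subsolution X (plus_init f A Q)"
proof -
  let ?F = "f Q" and ?G = "f A"
  define K where "K = ?F - ?G\<^sup>H ** matrix_inv X ** ?G"
  define L where "L = X - ?G ** matrix_inv ?F ** ?G\<^sup>H"
  note fX = pos_def[OF X]
  have "f (matrix_inv (f X)) = matrix_inv X"
    using inverse(2)[OF pos_def_invertible[OF fX]] by (simp add: invol)
  then have KfX: "pos_semidef (K - f X)"
    using pos[OF sub] by (simp add: diff mult ctranspose K_def)
  have K: "pos_def K"
    using pos_def_add[OF fX KfX] by simp
  have F: "pos_def ?F"
    using pos_def_add[OF K pos_semidef_congruence[OF pos_def_imp_pos_semidef[OF pos_def_matrix_inv[OF X]], of ?G]]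
    by (simp add: K_def)
  show "invertible (f Q)"
    by (rule pos_def_invertible[OF F])
  have L: "pos_def L"
    unfolding L_def by (rule schur_pos_def[OF F X]) (use K in \<open>simp add: K_def\<close>)
  have hF: "(matrix_inv ?F)\<^sup>H = matrix_inv ?F"
    using pos_def_matrix_inv[OF F] by (simp add: pos_defD hermitianD)
  have "matrix_inv K = matrix_inv ?F + matrix_inv ?F ** ?G\<^sup>H ** matrix_inv L ** ?G ** matrix_inv ?F"
    using block_inverse(3)[of ?F X "?G\<^sup>H" ?G, folded K_def L_def] F X K L
    by (simp add: pos_def_invertible)
  then have "riccati (plus_init f A Q) X = Q - A\<^sup>H ** matrix_inv K ** A"
    by (simp add: riccati_def plus_init_def ctranspose_simps hF mat_ring flip: L_def)
  moreover have "pos_semidef ((Q - A\<^sup>H ** matrix_inv K ** A) - (Q - A\<^sup>H ** matrix_inv (f X) ** A))"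
    using schur_mono[OF fX KfX, of A] by simp
  ultimately have "pos_semidef (riccati (plus_init f A Q) X - X)"
    using pos_semidef_trans[OF _ sub] by simp
  moreover have "hermitian (matrix_inv ?F)"
    using hF by (simp add: hermitian_def)
  ultimately show "subsolution X (plus_init f A Q)"
    using L Q unfolding subsolution_def plus_init_def L_def
    by (auto intro!: hermitian_diff hermitian_congruence hermitian_congruence')
qed

text \<open>
  Here the gap \<open>Q - B\<close> is \<open>L = Q + f(A) f(Q)\<^sup>-\<^sup>1 f(A)\<^sup>H\<close>. One Schur complement of \<open>L\<close> and \<open>f(Q)\<close> is \<open>Q\<close>; the
  other, \<open>f(Q) - f(A)\<^sup>H L\<^sup>-\<^sup>1 f(A)\<close>, is congruent to the Riccati value at \<open>Q\<close> minus \<open>Q\<close>.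
\<close>

lemma minus_init_subsolution:
  assumes Q: "pos_def Q"
  shows "invertible (f Q)" "subsolution Q (minus_init f A Q)"
proof -
  let ?F = "f Q" and ?G = "f A"
  define L where "L = Q + ?G ** matrix_inv ?F ** ?G\<^sup>H"
  note F = pos_def[OF Q]
  show "invertible (f Q)"
    by (rule pos_def_invertible[OF F])
  have psd: "pos_semidef (matrix_inv ?F)"
    by (intro pos_def_imp_pos_semidef pos_def_matrix_inv F)
  have hF: "(matrix_inv ?F)\<^sup>H = matrix_inv ?F"
    using psd by (simp add: pos_semidefD hermitianD)
  have L: "pos_def L"
    unfolding L_def using pos_def_add[OF Q pos_semidef_congruence[OF psd, of "?G\<^sup>H"]] by simp
  have "pos_semidef (?F - ?G\<^sup>H ** matrix_inv L ** ?G)"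
    using schur_pos_semidef[OF L F, of "?G\<^sup>H"] pos_def_imp_pos_semidef[OF Q] by (simp add: L_def)
  then have "pos_semidef ((matrix_inv ?F ** A)\<^sup>H ** (?F - ?G\<^sup>H ** matrix_inv L ** ?G) ** (matrix_inv ?F ** A))"
    by (rule pos_semidef_congruence)
  also have "(matrix_inv ?F ** A)\<^sup>H ** (?F - ?G\<^sup>H ** matrix_inv L ** ?G) ** (matrix_inv ?F ** A)
      = riccati (minus_init f A Q) Q - Q"
    by (simp add: riccati_def minus_init_def ctranspose_simps hF mat_ring
        matrix_inv_cancel[OF pos_def_invertible[OF F]] flip: L_def)
  finally have "pos_semidef (riccati (minus_init f A Q) Q - Q)" .
  moreover have "hermitian (matrix_inv ?F)"
    using hF by (simp add: hermitian_def)
  moreover have "hermitian Q"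
    by (rule pos_defD[OF Q])
  ultimately show "subsolution Q (minus_init f A Q)"
    using L unfolding subsolution_def minus_init_def L_def
    by (auto intro!: hermitian_add hermitian_uminus hermitian_congruence hermitian_congruence')
qed

end

section \<open>Convergence of the basic iteration\<close>

text \<open>
  Splitting the power \<open>k + m\<close> with the factor \<open>k\<close> last expresses the increment of \<open>B\<close> through
  \<open>A\<^sub>k\<close>; this yields both monotonicity and, later, the quadratic error bound.
\<close>

lemma B_of_basic_iter_add:
  assumes "subsolution Z S" "0 < k" "0 < m"
  shows "B_of (basic_iter S (k + m)) - B_of (basic_iter S k)
    = A_of (basic_iter S k) ** matrix_inv (Q_of (basic_iter S k) - B_of (basic_iter S m))
      ** (A_of (basic_iter S k))\<^sup>H"
  using basic_iter_add[OF assms] by (simp add: B_of_update)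

lemma B_of_basic_iter_mono:
  assumes S: "subsolution Z S" and "0 < k"
  shows "pos_semidef (B_of (basic_iter S (k + m)) - B_of (basic_iter S k))"
proof (cases "m = 0")
  case False
  have "pos_def (Q_of (basic_iter S k) - B_of (basic_iter S m))"
    by (intro subsolution_gap[of Z] subsolution_basic_iter S)
  then show ?thesis
    unfolding B_of_basic_iter_add[OF S \<open>0 < k\<close> False[unfolded neq0_conv]]
    using pos_semidef_congruence[OF pos_def_imp_pos_semidef[OF pos_def_matrix_inv],
        of _ "(A_of (basic_iter S k))\<^sup>H"] by simp
qed simp

lemma basic_iter_limits:
  assumes S: "subsolution Z S"
  obtains X Y where "(\<lambda>k. Q_of (basic_iter S k)) \<longlonglongrightarrow> X" "(\<lambda>k. B_of (basic_iter S k)) \<longlonglongrightarrow> Y"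
    "\<And>k. pos_semidef (Q_of (basic_iter S k) - X)" "subsolution X S" "riccati S X = X"
proof -
  let ?Q = "\<lambda>k. Q_of (basic_iter S k)" and ?B = "\<lambda>k. B_of (basic_iter S k)"
  note sub = subsolution_basic_iter[OF S]
  have Q_dec: "pos_semidef (?Q k - ?Q (Suc k))" for k
    using riccati_le[OF subsolution_gap[OF sub[of k] S]] by (simp add: Q_of_update)
  have Q_bdd: "pos_semidef (?Q k - Z)" for k
    by (rule subsolution_Q[OF sub])
  obtain X where X: "?Q \<longlonglongrightarrow> X" "pos_semidef (X - Z)" "\<And>k. pos_semidef (?Q k - X)"
    using pos_semidef_decreasing_convergent[of ?Q, OF Q_dec Q_bdd] by blast
  have B_dec: "pos_semidef (- ?B k - - ?B (Suc k))" for k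
    using B_of_basic_iter_mono[OF S, of k 1] by (cases "k = 0") simp_all
  have B_bdd: "pos_semidef (- ?B k - - Z)" for k
    using sub[of k] by (simp add: subsolution_def pos_def_imp_pos_semidef)
  obtain Y where "(\<lambda>k. - ?B k) \<longlonglongrightarrow> Y"
    using pos_semidef_decreasing_convergent[of "\<lambda>k. - ?B k", OF B_dec B_bdd] by blast
  then have Y: "?B \<longlonglongrightarrow> - Y"
    using tendsto_minus_cancel_left by blast
  have XB: "pos_def (X - B_of S)"
    using S pos_def_mono[OF _ X(2)] by (auto simp: subsolution_def)
  have step: "?Q (Suc k) = riccati S (?Q k)" if "0 < k" for k
    using basic_iter_add[OF S that, of 1] by (simp add: Q_of_update)
  have "(\<lambda>k. riccati S (?Q k)) \<longlonglongrightarrow> riccati S X"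
    unfolding riccati_def using X
    by (intro tendsto_intros tendsto_matrix_mult tendsto_matrix_inv_from_above XB) simp_all
  moreover have "eventually (\<lambda>k. riccati S (?Q k) = ?Q (Suc k)) sequentially"
    using step by (intro eventually_sequentiallyI[of 1]) (simp del: basic_iter.simps)
  ultimately have "(\<lambda>k. ?Q (Suc k)) \<longlonglongrightarrow> riccati S X"
    by (rule Lim_transform_eventually)
  then have fixed: "riccati S X = X"
    using LIMSEQ_Suc[OF X(1)] by (rule LIMSEQ_unique)
  moreover have "subsolution X S"
    using S XB fixed by (simp add: subsolution_def)
  ultimately show thesis
    using that[of X "- Y"] X Y by blast
qed

context
  fixes S :: "('a::real_or_complex^'n^'n) coeffs" and X :: "'a^'n^'n"
  assumes S: "subsolution X S" and fixed: "riccati S X = X"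
begin

lemma gap_pos_def: "pos_def (X - B_of (basic_iter S k))"
  using subsolution_basic_iter[OF S] by (simp add: subsolution_def)

lemma update_at_fixed_point:
  shows "riccati (update S (basic_iter S k)) X = riccati (basic_iter S k) X"
    and "closed_loop (update S (basic_iter S k)) X = closed_loop S X ** closed_loop (basic_iter S k) X"
    and "matrix_inv (X - B_of (update S (basic_iter S k))) = matrix_inv (X - B_of S)
      + closed_loop S X ** matrix_inv (X - B_of (basic_iter S k)) ** (closed_loop S X)\<^sup>H"
  using update_compose[of S "basic_iter S k" X] subsolution_gap[OF subsolution_basic_iter[OF S] S]
    gap_pos_def[of k] gap_pos_def[of 0]
  by (simp_all add: fixed)

lemma basic_iter_fixed_point: "riccati (basic_iter S k) X = X"
  by (induction k) (simp_all add: fixed update_at_fixed_point)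

lemma closed_loop_basic_iter:
  "0 < k \<Longrightarrow> closed_loop (basic_iter S k) X = matrix_power (closed_loop S X) k"
  by (induction k rule: nat_induct_non_zero) (simp_all add: update_at_fixed_point)

lemma A_of_basic_iter:
  "0 < k \<Longrightarrow> A_of (basic_iter S k) = (X - B_of (basic_iter S k)) ** matrix_power (closed_loop S X) k"
  using pos_def_invertible[OF gap_pos_def[of k]]
  by (simp flip: closed_loop_basic_iter)
    (simp add: closed_loop_def matrix_mul_assoc matrix_inv_right)

lemma Q_of_basic_iter_diff:
  "Q_of (basic_iter S k) - X = (A_of (basic_iter S k))\<^sup>H ** matrix_inv (X - B_of (basic_iter S k))
    ** A_of (basic_iter S k)"
  using basic_iter_fixed_point[of k] by (simp add: riccati_def algebra_simps)

lemma gap_bounded: "entry_norm (X - B_of (basic_iter S k)) \<le> real CARD('n) * entry_norm (X - B_of S)"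
proof (rule pos_semidef_entry_norm_mono)
  show "pos_semidef (X - B_of (basic_iter S k))"
    by (rule pos_def_imp_pos_semidef[OF gap_pos_def])
  have "pos_semidef (B_of (basic_iter S k) - B_of S)"
    using B_of_basic_iter_mono[OF S, of 1 "k - 1"] by (cases k) simp_all
  then show "pos_semidef (X - B_of S - (X - B_of (basic_iter S k)))"
    by simp
qed

lemma matrix_power_Suc_right: "matrix_power T (Suc k) = matrix_power T k ** T"
  by (induction k) (simp_all add: matrix_mul_assoc)

text \<open>
  The inverses \<open>W\<^sub>k = (X - B\<^sub>k)\<^sup>-\<^sup>1\<close> satisfy the Stein recursion \<open>W\<^bsub>k+1\<^esub> = W\<^sub>1 + T W\<^sub>k T\<^sup>H\<close> and are the partial
  sums of \<open>T\<^sup>j W\<^sub>1 (T\<^sup>j)\<^sup>H\<close>, a geometrically dominated series. The induction bounds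
  \<open>T\<^sup>j W\<^sub>k (T\<^sup>j)\<^sup>H\<close> for all \<open>j\<close> at once, so that no sums are needed.
\<close>

lemma gap_inverse_bounded:
  assumes "spec_radius (closed_loop S X) < 1"
  obtains D where "0 \<le> D" "\<And>k. 0 < k \<Longrightarrow> entry_norm (matrix_inv (X - B_of (basic_iter S k))) \<le> D"
proof -
  define T where "T = closed_loop S X"
  obtain s where s: "spec_radius T < s" "s < 1"
    using dense assms unfolding T_def by blast
  then have "0 < s"
    using spec_radius_nonneg[of T] by linarith
  obtain C where "0 < C" and C: "\<And>k. entry_norm (matrix_power T k) \<le> C * s ^ k"
    using matrix_power_growth[OF s(1)] by blast
  define q where "q = s * s"
  have q: "0 < q" "q < 1"
    using \<open>0 < s\<close> \<open>s < 1\<close> mult_strict_mono[of s 1 s 1] by (simp_all add: q_def)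
  define c where "c = C * entry_norm (matrix_inv (X - B_of S)) * C"
  have "0 \<le> c"
    using \<open>0 < C\<close> by (simp add: c_def)
  \<comment> \<open>The sum of the dominating geometric series, a fixed point of \<open>D \<mapsto> c + q D\<close>.\<close>
  define D where "D = c / (1 - q)"
  have "0 \<le> D" and D: "c + q * D = D"
    using q \<open>0 \<le> c\<close> by (simp_all add: D_def field_simps)
  have cD: "c \<le> D"
    using D \<open>0 \<le> D\<close> q mult_nonneg_nonneg[of q D] by linarith
  have base: "entry_norm (matrix_power T j ** matrix_inv (X - B_of S) ** (matrix_power T j)\<^sup>H) \<le> c * q ^ j" for j
  proof -
    have "entry_norm (matrix_power T j ** matrix_inv (X - B_of S) ** (matrix_power T j)\<^sup>H)
        \<le> C * s ^ j * entry_norm (matrix_inv (X - B_of S)) * (C * s ^ j)"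
      by (intro entry_norm_mult_le order_refl) (simp_all add: C)
    then show ?thesis
      by (simp add: c_def q_def power_mult_distrib mult_ac)
  qed
  have *: "entry_norm (matrix_power T j ** matrix_inv (X - B_of (basic_iter S k)) ** (matrix_power T j)\<^sup>H)
      \<le> D * q ^ j" if "0 < k" for k j
    using that
  proof (induction k arbitrary: j rule: nat_induct_non_zero)
    case 1
    have "c * q ^ j \<le> D * q ^ j"
      using cD q by (intro mult_right_mono) auto
    then show ?case
      using base[of j] by simp
  next
    case (Suc k)
    let ?W = "matrix_inv (X - B_of (basic_iter S k))"
    have "matrix_power T j ** matrix_inv (X - B_of (basic_iter S (Suc k))) ** (matrix_power T j)\<^sup>H
        = matrix_power T j ** matrix_inv (X - B_of S) ** (matrix_power T j)\<^sup>H
        + matrix_power T (Suc j) ** ?W ** (matrix_power T (Suc j))\<^sup>H"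
      using Suc.hyps unfolding matrix_power_Suc_right
      by (simp add: update_at_fixed_point T_def ctranspose_mult mat_ring)
    also have "entry_norm \<dots> \<le> c * q ^ j + D * q ^ Suc j"
      by (intro order_trans[OF entry_norm_add] add_mono base Suc.IH)
    also have "\<dots> = (c + q * D) * q ^ j"
      by (simp add: algebra_simps)
    finally show ?case
      by (simp add: D)
  qed
  have "entry_norm (matrix_inv (X - B_of (basic_iter S k))) \<le> D" if "0 < k" for k
    using *[OF that, of 0] by (simp add: ctranspose_mat)
  then show thesis
    using that \<open>0 \<le> D\<close> by blast
qed

lemma basic_iter_rates:
  assumes rho: "spec_radius (closed_loop S X) < s" "s < 1"
    and Q: "\<And>k. pos_semidef (Q_of (basic_iter S k) - X)"
    and B: "(\<lambda>k. B_of (basic_iter S k)) \<longlonglongrightarrow> Y"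
  obtains C where "\<And>k. 0 < k \<Longrightarrow> entry_norm (A_of (basic_iter S k)) \<le> C * s ^ k"
    "\<And>k. 0 < k \<Longrightarrow> entry_norm (Q_of (basic_iter S k) - X) \<le> C * (s\<^sup>2) ^ k"
    "\<And>k. 0 < k \<Longrightarrow> entry_norm (B_of (basic_iter S k) - Y) \<le> C * (s\<^sup>2) ^ k"
proof -
  let ?n = "real CARD('n)"
  obtain c where "0 < c" and c: "\<And>k. entry_norm (matrix_power (closed_loop S X) k) \<le> c * s ^ k"
    using matrix_power_growth[OF rho(1)] by blast
  obtain D where "0 \<le> D" and D: "\<And>k. 0 < k \<Longrightarrow> entry_norm (matrix_inv (X - B_of (basic_iter S k))) \<le> D"
    using gap_inverse_bounded rho by (metis order_less_trans)
  have "0 < s"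
    using rho spec_radius_nonneg by (metis order_le_less_trans)
  define a where "a = ?n * entry_norm (X - B_of S) * c"
  have "0 \<le> a"
    using \<open>0 < c\<close> by (simp add: a_def)
  have A: "entry_norm (A_of (basic_iter S k)) \<le> a * s ^ k" if "0 < k" for k
    using entry_norm_mult_le[OF gap_bounded[of k] c[of k]] by (simp add: A_of_basic_iter that a_def mult_ac)
  have sandwich: "entry_norm (M ** W ** N) \<le> a * a * w * (s\<^sup>2) ^ k"
    if "entry_norm M \<le> a * s ^ k" "entry_norm W \<le> w" "entry_norm N \<le> a * s ^ k"
    for M W N :: "'a^'n^'n" and w k
    using entry_norm_mult_le[OF entry_norm_mult_le[OF that(1,2)] that(3)]
    by (simp add: power2_eq_square power_mult_distrib mult_ac)
  have QX: "entry_norm (Q_of (basic_iter S k) - X) \<le> a * a * D * (s\<^sup>2) ^ k" if "0 < k" for k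
    unfolding Q_of_basic_iter_diff by (intro sandwich) (simp_all add: A D that)
  have BB: "entry_norm (B_of (basic_iter S (k + m)) - B_of (basic_iter S k)) \<le> a * a * (?n * D) * (s\<^sup>2) ^ k"
    if "0 < k" "0 < m" for k m
    unfolding B_of_basic_iter_add[OF S that]
  proof (intro sandwich)
    let ?Qk = "Q_of (basic_iter S k)" and ?Bm = "B_of (basic_iter S m)"
    have "pos_semidef (matrix_inv (X - ?Bm) - matrix_inv (?Qk - ?Bm))"
      by (rule matrix_inv_antimono[OF gap_pos_def]) (simp add: Q)
    moreover have "pos_def (?Qk - ?Bm)"
      by (intro subsolution_gap[of X] subsolution_basic_iter S)
    ultimately have "entry_norm (matrix_inv (?Qk - ?Bm)) \<le> ?n * entry_norm (matrix_inv (X - ?Bm))"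
      using pos_semidef_entry_norm_mono[OF pos_def_imp_pos_semidef[OF pos_def_matrix_inv]] by blast
    also have "\<dots> \<le> ?n * D"
      using D[OF \<open>0 < m\<close>] by (simp add: mult_left_mono)
    finally show "entry_norm (matrix_inv (?Qk - ?Bm)) \<le> ?n * D" .
  qed (simp_all add: A that)
  have BY: "entry_norm (B_of (basic_iter S k) - Y) \<le> a * a * (?n * D) * (s\<^sup>2) ^ k" if "0 < k" for k
  proof -
    have "(\<lambda>m. B_of (basic_iter S (k + m)) - B_of (basic_iter S k)) \<longlonglongrightarrow> Y - B_of (basic_iter S k)"
      using LIMSEQ_ignore_initial_segment[OF B, of k] by (intro tendsto_diff) (simp_all add: add.commute)
    then have "(\<lambda>m. entry_norm (B_of (basic_iter S (k + m)) - B_of (basic_iter S k))) \<longlonglongrightarrow> entry_norm (Y - B_of (basic_iter S k))"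
      by (rule entry_norm_tendsto)
    then have "entry_norm (Y - B_of (basic_iter S k)) \<le> a * a * (?n * D) * (s\<^sup>2) ^ k"
      by (rule tendsto_upperbound) (auto intro!: eventually_sequentiallyI[of 1] BB that)
    then show ?thesis
      by (simp add: entry_norm_def norm_minus_commute)
  qed
  define C where "C = max a (max (a * a * D) (a * a * (?n * D)))"
  have C: "a * s ^ k \<le> C * s ^ k" "a * a * D * (s\<^sup>2) ^ k \<le> C * (s\<^sup>2) ^ k"
    "a * a * (?n * D) * (s\<^sup>2) ^ k \<le> C * (s\<^sup>2) ^ k" for k
    using \<open>0 < s\<close> by (intro mult_right_mono; simp add: C_def)+
  show thesis
    by (rule that[of C]; rule order_trans) (rule A QX BY C; assumption?)+
qed

end

section \<open>Acceleration\<close>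

text \<open>
  A linear rate with every factor above \<open>\<rho>\<close> gives, along \<open>r ^ k\<close>, order \<open>r\<close> with such a factor; and as
  the \<open>r ^ k\<close>-th roots of the constants tend to \<open>1\<close>, only the factor survives in the limit superior.
\<close>

lemma superlinear_subsequence:
  fixes M Mh :: "nat \<Rightarrow> 'a::real_or_complex^'n^'n"
  assumes nrm: "matrix_norm nrm" and r: "1 < r" and rho: "0 \<le> \<rho>" "\<rho> < 1"
    and rate: "\<And>s. \<rho> < s \<Longrightarrow> s < 1 \<Longrightarrow> \<exists>C. \<forall>k>0. entry_norm (M k - L) \<le> C * s ^ k"
    and Mh: "\<And>k. Mh (Suc k) = M (r ^ k)"
  shows "Mh \<longlonglongrightarrow> L" and "R_superlinear nrm r Mh L"
    and "limsup (\<lambda>k. ereal (root (r ^ k) (nrm (Mh (k + 1) - L)))) \<le> ereal \<rho>"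
proof -
  obtain c where "0 < c" and c: "\<And>N. nrm N \<le> c * entry_norm N"
    using matrix_norm_le_entry_norm[OF nrm] by blast
  have pow_pos: "0 < r ^ k" for k
    using r by simp
  have rate': "\<exists>C>0. \<forall>k. entry_norm (M (r ^ k) - L) \<le> C * s ^ (r ^ k) \<and> nrm (M (r ^ k) - L) < C * s ^ (r ^ k)"
    if s: "\<rho> < s" "s < 1" for s
  proof -
    obtain C where C: "\<And>k. 0 < k \<Longrightarrow> entry_norm (M k - L) \<le> C * s ^ k"
      using rate[OF s] by blast
    define C' where "C' = (\<bar>C\<bar> + 1) * (c + 1)"
    have sp: "0 < s ^ (r ^ k)" for k
      using s rho by simp
    have 1: "entry_norm (M (r ^ k) - L) < (\<bar>C\<bar> + 1) * s ^ (r ^ k)" for k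
      using C[OF pow_pos, of k] mult_strict_right_mono[OF _ sp[of k], of C "\<bar>C\<bar> + 1"] by linarith
    have "0 < C'"
      using \<open>0 < c\<close> by (simp add: C'_def add_nonneg_pos)
    moreover have "entry_norm (M (r ^ k) - L) \<le> C' * s ^ (r ^ k)" for k
    proof -
      have "\<bar>C\<bar> + 1 \<le> C'"
        using \<open>0 < c\<close> by (simp add: C'_def algebra_simps)
      then show ?thesis
        using 1[of k] mult_right_mono[of "\<bar>C\<bar> + 1" C' "s ^ (r ^ k)"] sp[of k] by linarith
    qed
    moreover have "nrm (M (r ^ k) - L) < C' * s ^ (r ^ k)" for k
    proof -
      have "nrm (M (r ^ k) - L) \<le> c * ((\<bar>C\<bar> + 1) * s ^ (r ^ k))"
        using c[of "M (r ^ k) - L"] mult_left_mono[of _ _ c, OF less_imp_le[OF 1[of k]]] \<open>0 < c\<close> by linarith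
      also have "\<dots> < C' * s ^ (r ^ k)"
        using sp[of k] by (simp add: C'_def algebra_simps add_pos_nonneg)
      finally show ?thesis .
    qed
    ultimately show ?thesis by blast
  qed
  have mono: "strict_mono (\<lambda>k. r ^ k)"
    using r by (simp add: strict_mono_def power_strict_increasing)
  obtain s where s: "\<rho> < s" "s < 1"
    using dense rho(2) by blast
  obtain C where C: "0 < C" "\<And>k. entry_norm (M (r ^ k) - L) \<le> C * s ^ (r ^ k)"
    "\<And>k. nrm (M (r ^ k) - L) < C * s ^ (r ^ k)"
    using rate'[OF s] by blast
  have "(\<lambda>k. s ^ k) \<longlonglongrightarrow> 0"
    using s rho by (intro LIMSEQ_power_zero) auto
  from LIMSEQ_subseq_LIMSEQ[OF this mono] have "(\<lambda>k. C * s ^ (r ^ k)) \<longlonglongrightarrow> 0"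
    by (intro tendsto_mult_right_zero) (simp add: o_def)
  then have "(\<lambda>k. entry_norm (M (r ^ k) - L)) \<longlonglongrightarrow> 0"
    by (rule Lim_null_comparison[rotated]) (simp add: C)
  then have "(\<lambda>k. M (r ^ k)) \<longlonglongrightarrow> L"
    by (rule tendsto_entry_norm)
  then show "Mh \<longlonglongrightarrow> L"
    unfolding Mh[symmetric] by (rule LIMSEQ_imp_Suc)
  show "R_superlinear nrm r Mh L"
    unfolding R_superlinear_def Mh using C s rho by (intro exI[of _ C] exI[of _ s]) auto
  show "limsup (\<lambda>k. ereal (root (r ^ k) (nrm (Mh (k + 1) - L)))) \<le> ereal \<rho>"
  proof (rule dense_ge_bounded[where x = "ereal 1"])
    fix w assume "ereal \<rho> < w" "w < ereal 1"
    then obtain t where w: "w = ereal t" and t: "\<rho> < t" "t < 1"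
      by (cases w) auto
    obtain K where K: "0 < K" "\<And>k. nrm (M (r ^ k) - L) < K * t ^ (r ^ k)"
      using rate'[OF t] by blast
    have "(\<lambda>k. root k K) \<longlonglongrightarrow> 1"
      using K(1) by (rule LIMSEQ_root_const)
    from LIMSEQ_subseq_LIMSEQ[OF this mono] have "(\<lambda>k. root (r ^ k) K) \<longlonglongrightarrow> 1"
      by (simp add: o_def)
    then have "(\<lambda>k. root (r ^ k) K * t) \<longlonglongrightarrow> 1 * t"
      by (intro tendsto_intros)
    then have lim: "limsup (\<lambda>k. ereal (root (r ^ k) K * t)) = ereal t"
      by (intro lim_imp_Limsup) simp_all
    have "root (r ^ k) (nrm (Mh (k + 1) - L)) \<le> root (r ^ k) K * t" for k
    proof -
      have "root (r ^ k) (nrm (Mh (k + 1) - L)) \<le> root (r ^ k) (K * t ^ (r ^ k))"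
        using K(2)[of k] pow_pos[of k] by (simp add: Mh)
      also have "\<dots> = root (r ^ k) K * t"
        using t rho pow_pos[of k] by (simp add: real_root_mult real_root_power_cancel)
      finally show ?thesis .
    qed
    then have "limsup (\<lambda>k. ereal (root (r ^ k) (nrm (Mh (k + 1) - L)))) \<le> limsup (\<lambda>k. ereal (root (r ^ k) K * t))"
      by (intro Limsup_mono) simp
    then show "limsup (\<lambda>k. ereal (root (r ^ k) (nrm (Mh (k + 1) - L)))) \<le> w"
      by (simp add: lim w)
  qed (simp add: rho)
qed

section \<open>Convergence of the accelerated algorithm\<close>

theorem mainTheorem3:
  fixes f :: "'a::real_or_complex^'n^'n \<Rightarrow> 'a^'n^'n"
    and A Q X\<^sub>M Y\<^sub>M T\<^sub>1 :: "'a^'n^'n"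
    and S :: "('a^'n^'n) coeffs"
    and Ah Bh Qh :: "nat \<Rightarrow> 'a^'n^'n"
    and nrm :: "'a^'n^'n \<Rightarrow> real"
    and r :: nat
  assumes "matrix_norm nrm"
    and "continuous_on UNIV f"
    and "\<And>M. f (f M) = M"
    and "\<And>M N. f (M + N) = f M + f N"
    and "\<And>M N. f (M ** N) = f M ** f N"
    and "\<And>M. pos_semidef M \<Longrightarrow> pos_semidef (f M)"
    and "hermitian Q"
    and plus_or_minus:
      "(\<exists>X\<^sub>S. pos_def X\<^sub>S \<and> pos_semidef ((Q - A\<^sup>H ** matrix_inv (f X\<^sub>S) ** A) - X\<^sub>S))
          \<and> S = plus_init f A Q
       \<or> (pos_def Q \<and> invertible A) \<and> S = minus_init f A Q"
    and "X\<^sub>M = lim (\<lambda>k. Q_of (basic_iter S k))"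
    and "Y\<^sub>M = lim (\<lambda>k. B_of (basic_iter S k))"
    and "T\<^sub>1 = matrix_inv (X\<^sub>M - B_of S) ** A_of S"
    and "1 < r"
    and "Ah = (\<lambda>k. A_of (accel_iter r S k))"
    and "Bh = (\<lambda>k. B_of (accel_iter r S k))"
    and "Qh = (\<lambda>k. Q_of (accel_iter r S k))"
  shows
    "invertible (f Q)
     \<and> (\<forall>k\<ge>1. invertible (Q_of S - B_of (basic_iter S k)))
     \<and> convergent (\<lambda>k. Q_of (basic_iter S k))
     \<and> convergent (\<lambda>k. B_of (basic_iter S k))
     \<and> invertible (X\<^sub>M - B_of S)
     \<and> (\<forall>k\<ge>1. \<forall>i\<in>{1..r - 1}. invertible (Qh k - B_of (basic_iter (accel_iter r S k) i)))
     \<and> (spec_radius T\<^sub>1 < 1 \<longrightarrow>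
          Ah \<longlonglongrightarrow> 0 \<and> Qh \<longlonglongrightarrow> X\<^sub>M \<and> Bh \<longlonglongrightarrow> Y\<^sub>M
          \<and> R_superlinear nrm r Ah 0
          \<and> R_superlinear nrm r Qh X\<^sub>M
          \<and> R_superlinear nrm r Bh Y\<^sub>M
          \<and> limsup (\<lambda>k. ereal (root (r ^ k) (nrm (Ah (k + 1))))) \<le> ereal (spec_radius T\<^sub>1)
          \<and> limsup (\<lambda>k. ereal (root (r ^ k) (nrm (Qh (k + 1) - X\<^sub>M)))) \<le> ereal ((spec_radius T\<^sub>1)\<^sup>2)
          \<and> limsup (\<lambda>k. ereal (root (r ^ k) (nrm (Bh (k + 1) - Y\<^sub>M)))) \<le> ereal ((spec_radius T\<^sub>1)\<^sup>2))"
proof -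
  interpret positive_involution f
    by unfold_locales (fact assms)+
  note lims = \<open>X\<^sub>M = lim (\<lambda>k. Q_of (basic_iter S k))\<close> \<open>Y\<^sub>M = lim (\<lambda>k. B_of (basic_iter S k))\<close>
  have "\<exists>Z. invertible (f Q) \<and> subsolution Z S"
    using plus_or_minus
  proof
    assume "(\<exists>X\<^sub>S. pos_def X\<^sub>S \<and> pos_semidef ((Q - A\<^sup>H ** matrix_inv (f X\<^sub>S) ** A) - X\<^sub>S)) \<and> S = plus_init f A Q"
    then show ?thesis
      using plus_init_subsolution[OF \<open>hermitian Q\<close>] by blast
  next
    assume "(pos_def Q \<and> invertible A) \<and> S = minus_init f A Q"
    then show ?thesis
      using minus_init_subsolution by blast
  qed
  then obtain Z where fQ: "invertible (f Q)" and Z: "subsolution Z S"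
    by blast
  have gap: "invertible (Q_of (basic_iter S k) - B_of (basic_iter S l))" for k l
    using subsolution_gap[OF subsolution_basic_iter[OF Z] subsolution_basic_iter[OF Z]]
    by (rule pos_def_invertible)
  have accel: "accel_iter r S (Suc k) = basic_iter S (r ^ k)" for k
    by (rule accel_iter_eq_basic_iter[OF Z \<open>1 < r\<close>])
  have inner: "invertible (Qh k - B_of (basic_iter (accel_iter r S k) i))" if ki: "1 \<le> k" "i \<in> {1..r - 1}" for k i
  proof -
    obtain k' where k: "k = Suc k'"
      using ki(1) by (cases k) auto
    have "basic_iter (accel_iter r S k) i = basic_iter S (r ^ k' * i)"
      unfolding k accel by (rule basic_iter_basic_iter[OF Z]) (use ki(2) \<open>1 < r\<close> in auto)
    then show ?thesis
      unfolding \<open>Qh = _\<close> k accel using gap by simp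
  qed
  obtain X Y where QX: "(\<lambda>k. Q_of (basic_iter S k)) \<longlonglongrightarrow> X" and BY: "(\<lambda>k. B_of (basic_iter S k)) \<longlonglongrightarrow> Y"
    and above: "\<And>k. pos_semidef (Q_of (basic_iter S k) - X)" and X: "subsolution X S" "riccati S X = X"
    using basic_iter_limits[OF Z] by blast
  have XY: "X\<^sub>M = X" "Y\<^sub>M = Y"
    using lims limI[OF QX] limI[OF BY] by simp_all
  have T: "T\<^sub>1 = closed_loop S X"
    using \<open>T\<^sub>1 = _\<close> by (simp add: closed_loop_def XY)
  have conv: "Ah \<longlonglongrightarrow> 0 \<and> Qh \<longlonglongrightarrow> X\<^sub>M \<and> Bh \<longlonglongrightarrow> Y\<^sub>M
          \<and> R_superlinear nrm r Ah 0 \<and> R_superlinear nrm r Qh X\<^sub>M \<and> R_superlinear nrm r Bh Y\<^sub>M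
          \<and> limsup (\<lambda>k. ereal (root (r ^ k) (nrm (Ah (k + 1))))) \<le> ereal (spec_radius T\<^sub>1)
          \<and> limsup (\<lambda>k. ereal (root (r ^ k) (nrm (Qh (k + 1) - X\<^sub>M)))) \<le> ereal ((spec_radius T\<^sub>1)\<^sup>2)
          \<and> limsup (\<lambda>k. ereal (root (r ^ k) (nrm (Bh (k + 1) - Y\<^sub>M)))) \<le> ereal ((spec_radius T\<^sub>1)\<^sup>2)"
    if rho: "spec_radius T\<^sub>1 < 1"
  proof -
    let ?\<rho> = "spec_radius T\<^sub>1"
    have rho0: "0 \<le> ?\<rho>"
      by (rule spec_radius_nonneg)
    have rho2: "?\<rho>\<^sup>2 < 1"
      using rho0 rho by (simp add: power_less_one_iff)
    note rates = basic_iter_rates[OF X _ _ above BY, folded T]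
    have A_rate: "\<exists>C. \<forall>k>0. entry_norm (A_of (basic_iter S k) - 0) \<le> C * s ^ k" if "?\<rho> < s" "s < 1" for s
      unfolding diff_zero by (rule rates[OF that]) blast
    \<comment> \<open>A factor \<open>s > \<rho>\<^sup>2\<close> for the quadratic errors comes from the factor \<open>sqrt s > \<rho>\<close> for \<open>T\<close>.\<close>
    have sq: "?\<rho> < sqrt s" "sqrt s < 1" "(sqrt s)\<^sup>2 = s" if s: "?\<rho>\<^sup>2 < s" "s < 1" for s
      using s real_less_rsqrt[OF s(1)] order.strict_trans1[OF zero_le_power2 s(1)] by simp_all
    have Q_rate: "\<exists>C. \<forall>k>0. entry_norm (Q_of (basic_iter S k) - X) \<le> C * s ^ k" if "?\<rho>\<^sup>2 < s" "s < 1" for s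
      by (rule rates[OF sq(1,2)[OF that], unfolded sq(3)[OF that]]) blast
    have B_rate: "\<exists>C. \<forall>k>0. entry_norm (B_of (basic_iter S k) - Y) \<le> C * s ^ k" if "?\<rho>\<^sup>2 < s" "s < 1" for s
      by (rule rates[OF sq(1,2)[OF that], unfolded sq(3)[OF that]]) blast
    have Ah: "Ah (Suc k) = A_of (basic_iter S (r ^ k))" and Qh: "Qh (Suc k) = Q_of (basic_iter S (r ^ k))"
      and Bh: "Bh (Suc k) = B_of (basic_iter S (r ^ k))" for k
      unfolding \<open>Ah = _\<close> \<open>Qh = _\<close> \<open>Bh = _\<close> accel by rule+
    show ?thesis
      using superlinear_subsequence[OF \<open>matrix_norm nrm\<close> \<open>1 < r\<close> rho0 rho A_rate Ah]
        superlinear_subsequence[OF \<open>matrix_norm nrm\<close> \<open>1 < r\<close> zero_le_power2 rho2 Q_rate Qh]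
        superlinear_subsequence[OF \<open>matrix_norm nrm\<close> \<open>1 < r\<close> zero_le_power2 rho2 B_rate Bh]
      by (simp add: XY)
  qed
  have "invertible (X\<^sub>M - B_of S)"
    using X(1) by (simp add: XY subsolution_def pos_def_invertible)
  moreover have "invertible (Q_of S - B_of (basic_iter S k))" for k
    using gap[of 0 k] by simp
  ultimately show ?thesis
    using fQ QX BY inner conv by (auto simp: convergent_def)
qed

end
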